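(* Let $q=p^m$ be odd, let $T,\theta$ be functions such that $G=\{\mathfrak{g}_{a,b,c}\}$ is closed under $\circ$ and some $\theta_{a,b,c}$ is nontrivial, and let $g_2\in\mathrm{Aut}(\mathbb{F}_q)$ have order $p$. Then there exists $\mu_B\in\mathbb{F}_q$ with $g_C(\mu_B)=\mu_B$ such that $\theta_{a,b,0}=g_2^{\mathrm{tr}_{\mathbb{F}_q/\mathbb{F}_p}(\mu_Bb)}$ for all $a,b$; moreover $T(a,b,0)=M(b)$ for all $a,b\in\mathbb{F}_q$, and $M$ vanishes on $K_B=\{b:\mathrm{tr}_{\mathbb{F}_q/\mathbb{F}_p}(\mu_Bb)=0\}$. If furthermore $\mu_B\ne0$, then with $\nu_B:=M(t_B)$ we have $(1+g_B+\cdots+g_B^{p-1})(\nu_B)=0$ and $M(b)=N_B(\theta_{0,b,0})$ for all $b\in\mathbb{F}_q$, where $N_B(g_B^0)=0$ and $N_B(g_B^i)=(1+g_B+\cdots+g_B^{i-1})(\nu_B)$ for $1\le i\le p-1$.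
   Context: $T:\mathbb{F}_q^3\to\mathbb{F}_q$, $\theta:\mathbb{F}_q^3\to\mathrm{Aut}(\mathbb{F}_q)$, $\theta_{a,b,c}=\theta(a,b,c)$. $E(a,b,c,t)$ is the matrix with rows $(1,0,0,0),(-c,1,0,0),(b-ct,t,1,0),(a,b,c,1)$; $\mathfrak{g}_{a,b,c}=(E(a,b,c,T(a,b,c)),\theta_{a,b,c})$ with product $(A_1,\sigma_1)\circ(A_2,\sigma_2)=(A_1^{\sigma_2}A_2,\sigma_1\sigma_2)$; $G=\{\mathfrak{g}_{a,b,c}\}$. $M(y)=T(0,y,0)$, $\sigma_c=\theta_{0,0,c}$. $p^{r_B}$ is the exponent of $\{\theta_{0,b,0}:b\in\mathbb{F}_q\}$; $t_B\in\mathbb{F}_q$ is chosen with $g_B:=\theta_{0,t_B,0}$ of order $p^{r_B}$. $p^{r_C}=\max\{o(\sigma_c)\}$ and $t_C\in\mathbb{F}_q$ is chosen with $g_C:=\sigma_{t_C}$ of order $p^{r_C}$. *)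

theory Defs
  imports "HOL-Analysis.Cartesian_Space" "HOL-Computational_Algebra.Primes"
begin

definition field_aut :: "('a::field \<Rightarrow> 'a) \<Rightarrow> bool" where
  "field_aut \<sigma> \<longleftrightarrow> bij \<sigma> \<and> \<sigma> 1 = 1 \<and>
     (\<forall>x y. \<sigma> (x + y) = \<sigma> x + \<sigma> y) \<and> (\<forall>x y. \<sigma> (x * y) = \<sigma> x * \<sigma> y)"

definition aut_ord :: "('a \<Rightarrow> 'a) \<Rightarrow> nat" where
  "aut_ord \<sigma> = (LEAST n. 0 < n \<and> \<sigma> ^^ n = id)"

definition aut_exponent :: "('a \<Rightarrow> 'a) set \<Rightarrow> nat" where
  "aut_exponent S = (LEAST n. 0 < n \<and> (\<forall>\<sigma>\<in>S. \<sigma> ^^ n = id))"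

text \<open>The absolute trace of the field with \<open>p ^ m\<close> elements; its values lie in the prime
  field, regarded as a subset of the type \<open>'a\<close>.\<close>

definition abs_trace :: "nat \<Rightarrow> nat \<Rightarrow> 'a::field \<Rightarrow> 'a" where
  "abs_trace p m x = (\<Sum>i<m. x ^ (p ^ i))"

text \<open>For \<open>g\<close> of order \<open>p\<close> and \<open>x\<close> in the prime field with \<open>p\<close> elements, \<open>g\<close> raised to \<open>x\<close>:
  the exponent is the representative of \<open>x\<close> in \<open>{0..<p}\<close>.\<close>

definition prime_field_pow :: "('a::field \<Rightarrow> 'a) \<Rightarrow> 'a \<Rightarrow> ('a \<Rightarrow> 'a)" where
  "prime_field_pow g x = g ^^ (LEAST n. of_nat n = x)"

definition Emat :: "'a::field \<Rightarrow> 'a \<Rightarrow> 'a \<Rightarrow> 'a \<Rightarrow> 'a ^ 4 ^ 4" where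
  "Emat a b c t = vector
     [vector [1, 0, 0, 0],
      vector [- c, 1, 0, 0],
      vector [b - c * t, t, 1, 0],
      vector [a, b, c, 1]]"

text \<open>Automorphisms act on the right (\<open>A\<^sup>\<sigma>\<close> is entrywise application), so the product
  \<open>\<sigma>\<^sub>1\<sigma>\<^sub>2\<close> applies \<open>\<sigma>\<^sub>1\<close> first. Over a finite field the order is immaterial.\<close>

definition semilin_mult ::
  "('a::field ^ 4 ^ 4) \<times> ('a \<Rightarrow> 'a) \<Rightarrow> ('a ^ 4 ^ 4) \<times> ('a \<Rightarrow> 'a) \<Rightarrow> ('a ^ 4 ^ 4) \<times> ('a \<Rightarrow> 'a)"
  where
  "semilin_mult x y = (map_matrix (snd y) (fst x) ** fst y, snd y \<circ> snd x)"

definition gelem ::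
  "('a::field \<Rightarrow> 'a \<Rightarrow> 'a \<Rightarrow> 'a) \<Rightarrow> ('a \<Rightarrow> 'a \<Rightarrow> 'a \<Rightarrow> ('a \<Rightarrow> 'a)) \<Rightarrow> 'a \<Rightarrow> 'a \<Rightarrow> 'a
     \<Rightarrow> ('a ^ 4 ^ 4) \<times> ('a \<Rightarrow> 'a)" where
  "gelem T \<theta> a b c = (Emat a b c (T a b c), \<theta> a b c)"

definition Gset ::
  "('a::field \<Rightarrow> 'a \<Rightarrow> 'a \<Rightarrow> 'a) \<Rightarrow> ('a \<Rightarrow> 'a \<Rightarrow> 'a \<Rightarrow> ('a \<Rightarrow> 'a))
     \<Rightarrow> (('a ^ 4 ^ 4) \<times> ('a \<Rightarrow> 'a)) set" where
  "Gset T \<theta> = {gelem T \<theta> a b c | a b c. True}"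

end

theory Submission
  imports Defs "HOL-Number_Theory.Residues" "HOL-Computational_Algebra.Polynomial"
begin

text \<open>Write \<open>x y\<close> for the product of triples \<open>x = (a, b, c)\<close> induced by the closed set; then
  \<open>\<theta>\<close> is a homomorphism into the cyclic group of field automorphisms, with image of order at most
  \<open>m\<close>, and \<open>T\<close> is a crossed homomorphism. Conjugating an element \<open>(a, b, 0)\<close> of the kernel of \<open>\<theta>\<close>
  by elements of the kernel yields elements \<open>(2 c b, 0, 0)\<close> of the kernel with \<open>T = 0\<close>, where \<open>b\<close> and
  \<open>c\<close> range over additive subgroups so large that the products \<open>c b\<close> generate the field. Hence \<open>\<theta>\<close>
  and \<open>T\<close> are trivial on all \<open>(a, 0, 0)\<close>, and on \<open>c = 0\<close> they depend on \<open>b\<close> only. Let \<open>B0\<close> be the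
  set of \<open>b\<close> with trivial automorphism. The nilpotency of \<open>\<phi> - 1\<close>, for \<open>\<phi>\<close> an automorphism of
  \<open>p\<close>-power order, first gives \<open>M = 0\<close> on \<open>B0\<close>. Since \<open>1 + \<phi> + \<dots> + \<phi> ^ (n - 1) = (\<phi> - 1) ^ (n - 1)\<close>
  for a power \<open>n\<close> of \<open>p\<close>, it also shows that \<open>B0\<close> has index \<open>p ^ r\<close> with \<open>p ^ (r - 1) \<le> r\<close>, so
  \<open>r \<le> 1\<close> as \<open>p\<close> is odd. Thus \<open>b \<mapsto> \<theta> 0 b 0\<close> is an additive functional with values in the prime
  field, that is, a trace form.\<close>

section \<open>Additive subgroups\<close>

definition add_subgroup :: "'a::ab_group_add set \<Rightarrow> bool" where
  "add_subgroup H \<longleftrightarrow> 0 \<in> H \<and> (\<forall>x\<in>H. \<forall>y\<in>H. x - y \<in> H)"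

lemma add_subgroupI:
  assumes "0 \<in> H" and "\<And>x y. x \<in> H \<Longrightarrow> y \<in> H \<Longrightarrow> x - y \<in> H"
  shows "add_subgroup H"
  using assms by (simp add: add_subgroup_def)

lemma add_subgroup_zero: "add_subgroup H \<Longrightarrow> 0 \<in> H"
  by (simp add: add_subgroup_def)

lemma add_subgroup_diff: "add_subgroup H \<Longrightarrow> x \<in> H \<Longrightarrow> y \<in> H \<Longrightarrow> x - y \<in> H"
  by (simp add: add_subgroup_def)

lemma add_subgroup_minus: "add_subgroup H \<Longrightarrow> x \<in> H \<Longrightarrow> - x \<in> H"
  using add_subgroup_diff[of H 0 x] add_subgroup_zero by fastforce

lemma add_subgroup_add: "add_subgroup H \<Longrightarrow> x \<in> H \<Longrightarrow> y \<in> H \<Longrightarrow> x + y \<in> H"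
  using add_subgroup_diff[of H x "- y"] add_subgroup_minus by fastforce

lemma add_subgroup_image_mult:
  fixes k :: "'a::ring"
  assumes "add_subgroup H" shows "add_subgroup ((*) k ` H)"
proof (rule add_subgroupI)
  show "0 \<in> (*) k ` H"
    by (rule image_eqI[of _ _ 0]) (use assms add_subgroup_zero in auto)
  fix x y assume "x \<in> (*) k ` H" "y \<in> (*) k ` H"
  then obtain u v where "u \<in> H" "v \<in> H" "x = k * u" "y = k * v" by blast
  then show "x - y \<in> (*) k ` H"
    by (intro image_eqI[of _ _ "u - v"])
       (use assms add_subgroup_diff in \<open>auto simp: right_diff_distrib\<close>)
qed

lemma add_subgroup_of_nat_mult:
  fixes x :: "'a::ring_1"
  assumes "add_subgroup H" and "x \<in> H"
  shows "of_nat n * x \<in> H"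
  using assms by (induction n) (auto simp: algebra_simps intro: add_subgroup_zero add_subgroup_add)

section \<open>Counting fibres and products in a finite field\<close>

text \<open>Each fibre is covered by a copy of \<open>K\<close>. The copies are given by arbitrary
  maps \<open>g y\<close>, so that cosets for the twisted product of triples are allowed as
  well.\<close>

lemma card_le_card_range_mult_kernel:
  fixes f :: "'x::finite \<Rightarrow> 'y"
  assumes fibre: "\<And>y. {x. f x = f y} \<subseteq> g y ` K" and "finite K" and "card (range f) \<le> n"
  shows "CARD('x) \<le> n * card K"
proof -
  have fib: "card {x. f x = z} \<le> card K" if "z \<in> range f" for z
    using that fibre \<open>finite K\<close> by (auto intro: surj_card_le)
  have "CARD('x) = (\<Sum>x\<in>(UNIV::'x set). 1)"
    by simp
  also have "\<dots> = (\<Sum>z\<in>range f. \<Sum>x\<in>{x \<in> UNIV. f x = z}. 1)"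
    by (rule sum.group[symmetric]) auto
  also have "\<dots> = (\<Sum>z\<in>range f. card {x. f x = z})"
    by simp
  also have "\<dots> \<le> card (range f) * card K"
    using sum_bounded_above[of "range f", OF fib] by simp
  also have "\<dots> \<le> n * card K"
    using assms(3) by simp
  finally show ?thesis .
qed

text \<open>Counting the pairs \<open>(a, b)\<close> with \<open>a * b \<in> D\<close> in two ways replaces orthogonality of
  additive characters.\<close>

lemma sum_card_mult_in:
  fixes B D :: "'a::{field,finite} set"
  assumes "0 \<in> B" and "0 \<in> D"
  shows "(\<Sum>a\<in>UNIV. card {b \<in> B. a * b \<in> D}) = CARD('a) + (card B - 1) * card D"
proof -
  \<comment> \<open>For \<open>b \<noteq> 0\<close> the map \<open>a \<mapsto> a * b\<close> is a
    bijection; \<open>b = 0\<close> contributes every \<open>a\<close>, because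
    \<open>0 \<in> D\<close>.\<close>
  have *: "card {a. a * b \<in> D} = card D" if "b \<noteq> 0" for b
    using that
    by (intro bij_betw_same_card[of "\<lambda>a. a * b"] bij_betw_byWitness[where f' = "\<lambda>d. d / b"]) auto
  have "(\<Sum>a\<in>UNIV. card {b \<in> B. a * b \<in> D}) = (\<Sum>a\<in>UNIV. \<Sum>b\<in>{b \<in> B. a * b \<in> D}. 1)"
    by simp
  also have "\<dots> = (\<Sum>b\<in>B. \<Sum>a\<in>{a \<in> UNIV. a * b \<in> D}. 1)"
    by (rule sum.swap_restrict) auto
  also have "\<dots> = (\<Sum>b\<in>B. card {a. a * b \<in> D})"
    by simp
  also have "\<dots> = card {a. a * 0 \<in> D} + (\<Sum>b\<in>B - {0}. card {a. a * b \<in> D})"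
    by (rule sum.remove) (use assms in auto)
  also have "\<dots> = CARD('a) + (card B - 1) * card D"
    using assms by (simp add: * card_Diff_singleton)
  finally show ?thesis .
qed

text \<open>The homomorphism \<open>(b, d) \<mapsto> a * b + d\<close> on
  \<open>B \<times> D\<close> has at most \<open>CARD('a)\<close> values, and its kernel projects
  injectively into the counted set.\<close>

lemma card_mult_le_card_inter:
  fixes B D :: "'a::{field,finite} set"
  assumes B: "add_subgroup B" and D: "add_subgroup D"
  shows "card B * card D \<le> CARD('a) * card {b \<in> B. a * b \<in> D}"
proof -
  let ?I = "{b \<in> B. a * b \<in> D}"
  define f where "f = (\<lambda>(b, d). a * b + d)"
  have fib: "card {x \<in> B \<times> D. f x = y} \<le> card ?I" for y
  proof (cases "{x \<in> B \<times> D. f x = y} = {}")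
    case False
    then obtain b0 d0 where 0: "b0 \<in> B" "d0 \<in> D" "a * b0 + d0 = y"
      by (auto simp: f_def)
    show ?thesis
    proof (rule card_inj_on_le[where f = "\<lambda>x. fst x - b0"])
      show "inj_on (\<lambda>x. fst x - b0) {x \<in> B \<times> D. f x = y}"
        by (auto simp: inj_on_def f_def)
      show "(\<lambda>x. fst x - b0) ` {x \<in> B \<times> D. f x = y} \<subseteq> ?I"
      proof clarsimp
        fix b d assume b: "b \<in> B" "d \<in> D" "y = f (b, d)"
        have "a * (b - b0) = d0 - d"
          using 0 b by (simp add: f_def algebra_simps)
        then show "b - b0 \<in> B \<and> a * (b - b0) \<in> D"
          using 0 b B D by (metis add_subgroup_diff)
      qed
    qed auto
  next
    case True
    then show ?thesis by (metis card.empty le0)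
  qed
  have "card B * card D = card (B \<times> D)"
    by (simp add: card_cartesian_product)
  also have "\<dots> = (\<Sum>x\<in>B \<times> D. 1)"
    by simp
  also have "\<dots> = (\<Sum>y\<in>UNIV. \<Sum>x\<in>{x \<in> B \<times> D. f x = y}. 1)"
    by (rule sum.group[symmetric]) auto
  also have "\<dots> = (\<Sum>y\<in>UNIV. card {x \<in> B \<times> D. f x = y})"
    by simp
  also have "\<dots> \<le> (\<Sum>y\<in>(UNIV::'a set). card ?I)"
    by (rule sum_mono) (rule fib)
  finally show ?thesis by simp
qed

text \<open>The exact sum of the counts \<open>?N a\<close> is compared with a lower bound for each:
  all of \<open>B\<close> for \<open>a \<in> A\<close>, and \<open>card_mult_le_card_inter\<close>
  for the other \<open>a\<close>. With \<open>q = CARD('a)\<close> this becomes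
  \<open>card A * card B * (q - card D) \<le> q * (q - card D)\<close>.\<close>

lemma products_in_proper_subgroup:
  fixes A B D :: "'a::{field,finite} set"
  assumes B: "add_subgroup B" and D: "add_subgroup D"
    and AB: "\<And>a b. a \<in> A \<Longrightarrow> b \<in> B \<Longrightarrow> a * b \<in> D"
    and big: "CARD('a) < card A * card B"
  shows "D = UNIV"
proof (rule ccontr)
  assume "D \<noteq> UNIV"
  then have lt: "card D < CARD('a)"
    by (metis finite psubset_card_mono psubsetI top_greatest)
  let ?N = "\<lambda>a. card {b \<in> B. a * b \<in> D}"
  have B1: "card B \<ge> 1"
    using B add_subgroup_zero[of B] by (metis One_nat_def Suc_leI card_gt_0_iff empty_iff finite)
  have "card A * (CARD('a) * card B) + (CARD('a) - card A) * (card B * card D)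
      = (\<Sum>a\<in>A. CARD('a) * card B) + (\<Sum>a\<in>- A. card B * card D)"
    by (simp add: Compl_eq_Diff_UNIV card_Diff_subset)
  also have "\<dots> \<le> (\<Sum>a\<in>A. CARD('a) * ?N a) + (\<Sum>a\<in>- A. CARD('a) * ?N a)"
  proof (intro add_mono sum_mono)
    fix a assume "a \<in> A"
    then have "{b \<in> B. a * b \<in> D} = B" using AB by auto
    then show "CARD('a) * card B \<le> CARD('a) * ?N a" by simp
  qed (rule card_mult_le_card_inter[OF B D])
  also have "\<dots> = CARD('a) * (\<Sum>a\<in>UNIV. ?N a)"
    by (simp add: sum_distrib_left sum.union_disjoint[symmetric])
  also have "\<dots> = CARD('a) * (CARD('a) + (card B - 1) * card D)"
    using B D by (simp add: sum_card_mult_in add_subgroup_zero)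
  finally have *: "card A * (CARD('a) * card B) + (CARD('a) - card A) * (card B * card D)
      \<le> CARD('a) * (CARD('a) + (card B - 1) * card D)" .
  have "card A \<le> CARD('a)"
    by (simp add: card_mono)
  \<comment> \<open>Passing to integers makes the subtractions exact.\<close>
  then have "int (card A) * (int CARD('a) * int (card B))
      + (int CARD('a) - int (card A)) * (int (card B) * int (card D))
      \<le> int CARD('a) * (int CARD('a) + (int (card B) - 1) * int (card D))"
    using * B1 by (metis (mono_tags, lifting) of_nat_1 of_nat_add of_nat_diff of_nat_le_iff of_nat_mult)
  then have "(int (card A) * int (card B)) * (int CARD('a) - int (card D))
      \<le> int CARD('a) * (int CARD('a) - int (card D))"
    by (simp add: algebra_simps)
  then have "int (card A) * int (card B) \<le> int CARD('a)"
    using lt by (simp add: mult_le_cancel_right)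
  then show False
    using big by (metis not_le of_nat_le_iff of_nat_mult)
qed

section \<open>The nilpotent operator \<open>\<phi> - 1\<close>\<close>

lemma additive_funpow:
  fixes f :: "'a::ab_group_add \<Rightarrow> 'a"
  assumes "additive f" shows "additive (f ^^ n)"
proof -
  have "(f ^^ n) (x + y) = (f ^^ n) x + (f ^^ n) y" for x y
    using additive.add[OF assms] by (induction n) auto
  then show ?thesis by unfold_locales
qed

lemma additive_of_nat_mult:
  fixes f :: "'a::ring_1 \<Rightarrow> 'a"
  assumes "additive f" shows "f (of_nat n * x) = of_nat n * f x"
  using assms by (induction n) (auto simp: algebra_simps additive.zero additive.add)

definition dif :: "('a \<Rightarrow> 'a) \<Rightarrow> 'a::ab_group_add \<Rightarrow> 'a" where
  "dif \<phi> x = \<phi> x - x"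

lemma additive_dif: "additive \<phi> \<Longrightarrow> additive (dif \<phi>)"
  by (auto simp: additive_def dif_def)

text \<open>Binomial expansion of \<open>\<phi> = 1 + dif \<phi>\<close>; the induction step is
  Pascal's rule.\<close>

lemma funpow_eq_sum_dif:
  fixes \<phi> :: "'a::ring_1 \<Rightarrow> 'a"
  assumes "additive \<phi>"
  shows "(\<phi> ^^ n) x = (\<Sum>j\<le>n. of_nat (n choose j) * (dif \<phi> ^^ j) x)"
proof (induction n)
  case (Suc n)
  let ?d = "\<lambda>j. (dif \<phi> ^^ j) x"
  have "(\<phi> ^^ Suc n) x = \<phi> (\<Sum>j\<le>n. of_nat (n choose j) * ?d j)"
    by (simp add: Suc.IH)
  also have "\<dots> = (\<Sum>j\<le>n. of_nat (n choose j) * (?d j + ?d (Suc j)))"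
    by (simp add: additive.sum[OF assms] additive_of_nat_mult[OF assms] dif_def)
  also have "\<dots> = (\<Sum>j\<le>n. of_nat (n choose j) * ?d j) + (\<Sum>j\<le>n. of_nat (n choose j) * ?d (Suc j))"
    by (simp add: distrib_left sum.distrib)
  also have "(\<Sum>j\<le>n. of_nat (n choose j) * ?d j) = (\<Sum>j\<le>Suc n. of_nat (n choose j) * ?d j)"
    by (simp add: binomial_eq_0)
  also have "\<dots> = ?d 0 + (\<Sum>j\<le>n. of_nat (n choose Suc j) * ?d (Suc j))"
    by (subst sum.atMost_Suc_shift) simp
  also have "?d 0 + (\<Sum>j\<le>n. of_nat (n choose Suc j) * ?d (Suc j))
      + (\<Sum>j\<le>n. of_nat (n choose j) * ?d (Suc j))
      = (\<Sum>j\<le>Suc n. of_nat (Suc n choose j) * ?d j)"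
    by (subst sum.atMost_Suc_shift) (simp add: sum.distrib distrib_right del: funpow.simps)
  finally show ?case .
qed simp

text \<open>This is \<open>((1 + X) ^ n - 1) / X\<close> expanded in
  \<open>X = dif \<phi>\<close>.\<close>

lemma sum_funpow_eq_sum_dif:
  fixes \<phi> :: "'a::ring_1 \<Rightarrow> 'a"
  assumes "additive \<phi>"
  shows "(\<Sum>i<n. (\<phi> ^^ i) x) = (\<Sum>j<n. of_nat (n choose Suc j) * (dif \<phi> ^^ j) x)"
proof (induction n)
  case (Suc n)
  have "(\<Sum>i<Suc n. (\<phi> ^^ i) x)
      = (\<Sum>j<Suc n. of_nat (n choose Suc j) * (dif \<phi> ^^ j) x)
        + (\<Sum>j<Suc n. of_nat (n choose j) * (dif \<phi> ^^ j) x)"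
    using Suc.IH funpow_eq_sum_dif[OF assms, of n x]
    by (simp add: lessThan_Suc_atMost[symmetric] binomial_eq_0)
  then show ?case
    by (simp only: sum.distrib[symmetric] distrib_right[symmetric] of_nat_add[symmetric]
        binomial_Suc_Suc add.commute)
qed simp

text \<open>If \<open>p\<close> did not divide the binomial coefficient, the absorption identity
  would force \<open>p ^ k\<close> to divide \<open>j\<close>.\<close>

lemma prime_dvd_choose_prime_power:
  assumes "prime (p::nat)" and "0 < j" and "j < p ^ k"
  shows "p dvd (p ^ k choose j)"
proof (rule ccontr)
  assume "\<not> p dvd (p ^ k choose j)"
  then have "coprime (p ^ k) (p ^ k choose j)"
    using assms(1) by (simp add: prime_imp_coprime)
  moreover have "j * (p ^ k choose j) = p ^ k * ((p ^ k - 1) choose (j - 1))"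
    using times_binomial_minus1_eq[OF assms(2)] by simp
  ultimately have "p ^ k dvd j"
    by (metis coprime_dvd_mult_left_iff dvd_triv_left)
  then show False
    using assms by (simp add: nat_dvd_not_less)
qed

text \<open>In characteristic \<open>p\<close> only the top binomial coefficient survives in the
  expansion of the geometric sum.\<close>

lemma sum_funpow_prime_power:
  fixes \<phi> :: "'a::ring_1 \<Rightarrow> 'a"
  assumes "additive \<phi>" and p: "prime p" "CHAR('a) = p"
  shows "(\<Sum>i<p ^ k. (\<phi> ^^ i) x) = (dif \<phi> ^^ (p ^ k - 1)) x"
proof -
  have pos: "p ^ k > 0"
    using p prime_gt_0_nat by simp
  have "(\<Sum>i<p ^ k. (\<phi> ^^ i) x)
      = (\<Sum>j<p ^ k. of_nat (p ^ k choose Suc j) * (dif \<phi> ^^ j) x)"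
    by (rule sum_funpow_eq_sum_dif[OF assms(1)])
  also have "\<dots> = (\<Sum>j\<in>{p ^ k - 1}. of_nat (p ^ k choose Suc j) * (dif \<phi> ^^ j) x)"
  proof (intro sum.mono_neutral_right ballI)
    fix j assume "j \<in> {..<p ^ k} - {p ^ k - 1}"
    then have "p dvd (p ^ k choose Suc j)"
      using p by (intro prime_dvd_choose_prime_power) auto
    then have "of_nat (p ^ k choose Suc j) = (0::'a)"
      using p by (simp add: of_nat_eq_0_iff_char_dvd)
    then show "of_nat (p ^ k choose Suc j) * (dif \<phi> ^^ j) x = 0"
      by simp
  qed (use pos in auto)
  also have "\<dots> = (dif \<phi> ^^ (p ^ k - 1)) x"
    using pos by simp
  finally show ?thesis .
qed

lemma dif_sum_funpow:
  assumes "additive \<phi>"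
  shows "dif \<phi> (\<Sum>i<n. (\<phi> ^^ i) x) = (\<phi> ^^ n) x - x"
  by (induction n)
     (simp_all add: dif_def additive.zero[OF assms] additive.add[OF assms] algebra_simps)

lemma sum_funpow_Suc:
  assumes "additive \<phi>"
  shows "(\<Sum>i<Suc n. (\<phi> ^^ i) x) = \<phi> (\<Sum>i<n. (\<phi> ^^ i) x) + x"
  by (subst sum.lessThan_Suc_shift) (simp add: additive.sum[OF assms] add.commute)

text \<open>Applying \<open>dif \<phi>\<close> once more to the geometric sum telescopes. The
  consequence used later is that \<open>dif \<phi>\<close> is nilpotent when
  \<open>\<phi> ^^ (p ^ k) = id\<close>.\<close>

lemma dif_funpow_prime_power:
  fixes \<phi> :: "'a::ring_1 \<Rightarrow> 'a"
  assumes "additive \<phi>" and p: "prime p" "CHAR('a) = p"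
  shows "(dif \<phi> ^^ (p ^ k)) x = (\<phi> ^^ (p ^ k)) x - x"
proof -
  have "p ^ k = Suc (p ^ k - 1)"
    using p prime_gt_0_nat by simp
  then have "(dif \<phi> ^^ (p ^ k)) x = dif \<phi> ((dif \<phi> ^^ (p ^ k - 1)) x)"
    by (metis funpow.simps(2) comp_apply)
  then show ?thesis
    using dif_sum_funpow[OF assms(1), where n = "p ^ k"] sum_funpow_prime_power[OF assms] by metis
qed

section \<open>Finite fields\<close>

lemma field_aut_additive: "field_aut \<sigma> \<Longrightarrow> additive \<sigma>"
  by (simp add: field_aut_def additive_def)

lemma field_aut_zero: "field_aut \<sigma> \<Longrightarrow> \<sigma> 0 = 0"
  by (simp add: field_aut_additive additive.zero)

lemma field_aut_add: "field_aut \<sigma> \<Longrightarrow> \<sigma> (x + y) = \<sigma> x + \<sigma> y"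
  by (simp add: field_aut_def)

lemma field_aut_mult: "field_aut \<sigma> \<Longrightarrow> \<sigma> (x * y) = \<sigma> x * \<sigma> y"
  by (simp add: field_aut_def)

lemma field_aut_one: "field_aut \<sigma> \<Longrightarrow> \<sigma> 1 = 1"
  by (simp add: field_aut_def)

lemma field_aut_inj: "field_aut \<sigma> \<Longrightarrow> \<sigma> x = \<sigma> y \<longleftrightarrow> x = y"
  by (auto simp: field_aut_def bij_def dest: injD)

lemma field_aut_surj: "field_aut \<sigma> \<Longrightarrow> \<exists>x. \<sigma> x = y"
  by (metis bij_pointE field_aut_def)

lemma field_aut_of_nat: "field_aut \<sigma> \<Longrightarrow> \<sigma> (of_nat n) = of_nat n"
  by (induction n) (auto simp: field_aut_zero field_aut_add field_aut_one)

lemma field_aut_power: "field_aut \<sigma> \<Longrightarrow> \<sigma> (x ^ n) = \<sigma> x ^ n"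
  by (induction n) (auto simp: field_aut_mult field_aut_one)

lemma map_poly_mult_hom:
  fixes f :: "'a::comm_ring_1 \<Rightarrow> 'b::comm_ring_1"
  assumes "additive f" and "\<And>x y. f (x * y) = f x * f y"
  shows "map_poly f (r * s) = map_poly f r * map_poly f s"
  by (rule poly_eqI)
     (simp add: coeff_map_poly coeff_mult assms additive.zero[OF assms(1)] additive.sum[OF assms(1)])

lemma map_poly_prod_linear:
  fixes f :: "'a::comm_ring_1 \<Rightarrow> 'b::comm_ring_1"
  assumes f: "additive f" "\<And>x y. f (x * y) = f x * f y" "f 1 = 1"
  shows "map_poly f (\<Prod>i<(n::nat). [:- u i, 1:]) = (\<Prod>i<n. [:- f (u i), 1:])"
proof (induction n)
  case (Suc n)
  have "map_poly f [:- u n, 1:] = [:- f (u n), 1:]"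
    by (simp add: map_poly_pCons additive.zero additive.minus f)
  then show ?case
    using Suc by (simp add: map_poly_mult_hom[OF f(1,2)] del: mult_pCons_right mult_pCons_left)
qed (simp add: f)

lemma field_power_CARD: "(x::'a::{field,finite}) ^ CARD('a) = x"
proof (cases "x = 0")
  case False
  let ?U = "UNIV - {0::'a}"
  \<comment> \<open>Multiplication by \<open>x\<close> permutes the nonzero elements.\<close>
  have "\<Prod>?U = (\<Prod>y\<in>?U. x * y)"
    using False by (intro prod.reindex_bij_witness[of _ "\<lambda>y. x * y" "\<lambda>y. y / x"]) auto
  then have "x ^ card ?U = 1"
    by (simp add: prod.distrib)
  moreover have "CARD('a) = Suc (card ?U)"
    by (simp add: card_Diff_singleton)
  ultimately show ?thesis
    by (metis power_Suc mult_1_right)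
qed (simp add: power_0_left)

lemma finite_field_generator:
  obtains \<gamma> :: "'a::{field,finite}" where "\<And>x. x \<noteq> 0 \<Longrightarrow> \<exists>i::nat. x = \<gamma> ^ i"
proof -
  \<comment> \<open>The field is repackaged as a ring with explicit carrier in order to use the
    cyclicity of the multiplicative group of a finite field.\<close>
  define R :: "'a ring" where
    "R = \<lparr>carrier = UNIV, mult = (*), one = 1, zero = 0, add = (+)\<rparr>"
  have "cring R"
  proof (rule cringI)
    show "abelian_group R"
    proof (rule abelian_groupI)
      fix x assume "x \<in> carrier R"
      show "\<exists>y\<in>carrier R. y \<oplus>\<^bsub>R\<^esub> x = \<zero>\<^bsub>R\<^esub>"
        by (rule bexI[of _ "- x"]) (simp_all add: R_def)
    qed (simp_all add: R_def add_ac)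
    show "Group.comm_monoid R"
      by (rule comm_monoidI) (simp_all add: R_def mult_ac)
  qed (simp add: R_def distrib_right)
  then interpret R: field R
  proof (rule cring.cring_fieldI2)
    fix x assume "x \<in> carrier R" "x \<noteq> \<zero>\<^bsub>R\<^esub>"
    then show "\<exists>y\<in>carrier R. x \<otimes>\<^bsub>R\<^esub> y = \<one>\<^bsub>R\<^esub>"
      by (intro bexI[of _ "inverse x"]) (simp_all add: R_def)
  qed (simp add: R_def)
  have pow: "x [^]\<^bsub>R\<^esub> (i::nat) = x ^ i" for x i
    by (induction i) (auto simp: R_def)
  obtain \<gamma> where "carrier (mult_of R) = {\<gamma> [^]\<^bsub>R\<^esub> i | i::nat. i \<in> UNIV}"
    using R.finite_field_mult_group_has_gen by (auto simp: R_def)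
  then have "UNIV - {0} = {\<gamma> ^ i | i. True}"
    by (simp add: pow) (simp add: R_def)
  then show ?thesis
    using that by blast
qed

locale finite_field_card =
  fixes p m :: nat and F :: "'a::{field,finite} itself"
  assumes prime_p: "prime p" and card_field: "CARD('a) = p ^ m"
begin

lemma CHAR_field: "CHAR('a) = p"
proof -
  have "prime CHAR('a)"
    by (intro prime_CHAR_semidom finite_imp_CHAR_pos) simp
  then show ?thesis
    using CHAR_dvd_CARD[where 'a = 'a] prime_p card_field
    by (metis prime_dvd_power primes_dvd_imp_eq)
qed

lemma p_gt_1: "p > 1"
  using prime_p prime_gt_1_nat by blast

lemma m_pos: "m > 0"
proof -
  have "CARD('a) \<ge> card {0, 1::'a}"
    by (intro card_mono) auto
  then show ?thesis
    using card_field by (cases m) auto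
qed

lemma of_nat_eq_0_iff: "of_nat n = (0::'a) \<longleftrightarrow> p dvd n"
  by (simp add: of_nat_eq_0_iff_char_dvd CHAR_field)

lemma of_nat_eq_iff: "of_nat i = (of_nat j :: 'a) \<longleftrightarrow> [i = j] (mod p)"
  by (simp add: of_nat_eq_iff_cong_CHAR CHAR_field)

text \<open>For \<open>x\<close> in \<open>H'\<close> outside \<open>H\<close>, the \<open>p\<close>
  translates of \<open>H\<close> by \<open>of_nat i * x\<close> are disjoint: a nonzero difference
  of two indices is invertible modulo \<open>p\<close>, so an overlap would put \<open>x\<close>
  into \<open>H\<close>.\<close>

lemma card_proper_subgroup:
  fixes H :: "'a set"
  assumes H: "add_subgroup H" and H': "add_subgroup H'" and "H \<subset> H'"
  shows "p * card H \<le> card H'"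
proof -
  obtain x where x: "x \<in> H'" "x \<notin> H"
    using \<open>H \<subset> H'\<close> by blast
  have ind: "i = j" if "i < p" "j < p" "of_nat i * x - of_nat j * x \<in> H" "j \<le> i" for i j
  proof (rule ccontr)
    assume "i \<noteq> j"
    with that have k: "0 < i - j" "i - j < p" by auto
    then have "coprime (i - j) p"
      using prime_p by (metis coprime_commute nat_dvd_not_less prime_imp_coprime)
    then obtain l where "[(i - j) * l = 1] (mod p)"
      by (metis cong_solve_coprime_nat One_nat_def)
    then have "of_nat ((i - j) * l) = (1::'a)"
      by (metis of_nat_1 of_nat_eq_iff)
    then have "x = of_nat l * (of_nat (i - j) * x)"
      by (metis mult.assoc mult.commute mult.left_neutral of_nat_mult)
    also have "\<dots> \<in> H"
      using that H by (metis add_subgroup_of_nat_mult left_diff_distrib of_nat_diff)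
    finally show False using x by simp
  qed
  let ?f = "\<lambda>(i, h). of_nat i * x + h"
  have "inj_on ?f ({..<p} \<times> H)"
  proof (rule inj_onI, clarsimp)
    fix i h j k assume *: "i < p" "h \<in> H" "j < p" "k \<in> H" "of_nat i * x + h = of_nat j * x + k"
    then have "of_nat i * x - of_nat j * x = k - h" "of_nat j * x - of_nat i * x = h - k"
      by (auto simp: algebra_simps)
    then have "i = j"
      using * H ind[of i j] ind[of j i] by (metis add_subgroup_diff nat_le_linear)
    with * show "i = j \<and> h = k" by simp
  qed
  moreover have "?f ` ({..<p} \<times> H) \<subseteq> H'"
    using H' x \<open>H \<subset> H'\<close> by (auto intro!: add_subgroup_add add_subgroup_of_nat_mult)
  ultimately have "card ({..<p} \<times> H) \<le> card H'"
    by (intro card_inj_on_le) auto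
  then show ?thesis by (simp add: card_cartesian_product)
qed

text \<open>The preimages of \<open>H\<close> under the powers of \<open>\<phi> - 1\<close> grow strictly until they exhaust the
  field, because \<open>\<phi> - 1\<close> is nilpotent.\<close>

lemma dif_funpow_in_subgroup:
  fixes H :: "'a set" and \<phi> :: "'a \<Rightarrow> 'a"
  assumes H: "add_subgroup H" and \<phi>: "additive \<phi>" "\<phi> ^^ (p ^ k) = id"
    and inv: "\<And>x. x \<in> H \<Longrightarrow> \<phi> x \<in> H"
    and big: "CARD('a) \<le> p ^ r * card H"
  shows "(dif \<phi> ^^ r) x \<in> H"
proof -
  define V where "V i = {x. (dif \<phi> ^^ i) x \<in> H}" for i
  note dadd = additive_dif[OF \<phi>(1)]
  have dH: "dif \<phi> x \<in> H" if "x \<in> H" for x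
    using that inv H by (simp add: dif_def add_subgroup_diff)
  have sub: "add_subgroup (V i)" for i
    using additive.zero[OF additive_funpow[OF dadd]] additive.diff[OF additive_funpow[OF dadd]] H
    by (auto intro!: add_subgroupI simp: V_def add_subgroup_zero add_subgroup_diff)
  have mono: "V i \<subseteq> V (Suc i)" for i
    using dH by (auto simp: V_def)
  have top: "V (p ^ k) = UNIV"
    using dif_funpow_prime_power[OF \<phi>(1) prime_p CHAR_field, of k] \<phi>(2) H
    by (auto simp: V_def add_subgroup_zero)
  \<comment> \<open>Once the chain stalls it is constant, hence equal to its later member that
    contains \<open>V (p ^ k) = UNIV\<close>.\<close>
  have full: "V i = UNIV" if "V i = V (Suc i)" for i
  proof -
    have "V (i + j) = V i" for j
    proof (induction j)
      case (Suc j)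
      have "x \<in> V i" if "x \<in> V (i + Suc j)" for x
      proof -
        have "(dif \<phi> ^^ j) x \<in> V (Suc i)"
          using that by (simp add: V_def funpow_add)
        then have "x \<in> V (i + j)"
          using \<open>V i = V (Suc i)\<close> by (auto simp: V_def funpow_add)
        then show ?thesis using Suc by simp
      qed
      moreover have "V i \<subseteq> V (i + Suc j)"
        using mono[of "i + j"] Suc by simp
      ultimately show ?case by auto
    qed simp
    moreover have "V (p ^ k) \<subseteq> V (p ^ k + i)"
      by (rule lift_Suc_mono_le[of V, OF mono]) simp
    ultimately show ?thesis
      using top by (metis UNIV_I add.commute subset_UNIV subset_antisym)
  qed
  \<comment> \<open>Every strict step multiplies the size by at least \<open>p\<close>, so the chain
    is full after \<open>r\<close> steps.\<close>
  have "V i = UNIV \<or> p ^ i * card H \<le> card (V i)" for i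
  proof (induction i)
    case (Suc i)
    show ?case
    proof (cases "V i = UNIV")
      case True
      then show ?thesis using mono[of i] by auto
    next
      case False
      then have "V i \<subset> V (Suc i)"
        using mono full by blast
      then have "p * card (V i) \<le> card (V (Suc i))"
        by (rule card_proper_subgroup[OF sub sub])
      moreover have "p * (p ^ i * card H) \<le> p * card (V i)"
        using Suc False by simp
      ultimately have "p * (p ^ i * card H) \<le> card (V (Suc i))"
        by (rule order_trans[rotated])
      then show ?thesis by (simp add: mult.assoc)
    qed
  qed (simp add: V_def)
  then have "V r = UNIV"
    using big by (metis card_seteq dual_order.trans finite subset_UNIV)
  then show ?thesis by (auto simp: V_def)
qed

section \<open>The prime field, the Frobenius map and the cyclic group of automorphisms\<close>

lemma power_p_add: "(x + y :: 'a) ^ p = x ^ p + y ^ p"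
  using prime_p CHAR_field by (intro freshmans_dream) auto

lemma card_fixed_points_le:
  assumes "0 < j"
  shows "card {x::'a. x ^ (p ^ j) = x} \<le> p ^ j"
proof -
  let ?q = "monom 1 (p ^ j) + [:0, - 1::'a:]"
  have "1 < p ^ j"
    using assms p_gt_1 by (rule one_less_power[rotated])
  then have deg: "degree ?q = p ^ j"
    by (subst degree_add_eq_left) (auto simp: degree_monom_eq)
  then have "?q \<noteq> 0"
    using \<open>1 < p ^ j\<close> by (metis degree_0 not_one_less_zero)
  then have "card {x. poly ?q x = 0} \<le> p ^ j"
    using card_poly_roots_bound deg by metis
  moreover have "{x. poly ?q x = 0} = {x. x ^ (p ^ j) = x}"
    by (auto simp: poly_monom)
  ultimately show ?thesis by simp
qed

lemma of_nat_power_p: "of_nat n ^ p = (of_nat n :: 'a)"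
  using p_gt_1 by (induction n) (auto simp: power_p_add power_0_left)

text \<open>The \<open>p\<close> distinct residues are roots of \<open>X ^ p - X\<close>, which has
  at most \<open>p\<close> roots.\<close>

lemma prime_field_of_nat:
  assumes "x ^ p = (x::'a)"
  obtains n where "n < p" and "x = of_nat n"
proof -
  have "of_nat ` {..<p} \<subseteq> {x::'a. x ^ p = x}"
    by (auto simp: of_nat_power_p)
  moreover have "card (of_nat ` {..<p} :: 'a set) = p"
    by (subst card_image) (auto simp: inj_on_def of_nat_eq_iff intro: cong_less_modulus_unique_nat)
  moreover have "card {x::'a. x ^ p = x} \<le> p"
    using card_fixed_points_le[of 1] by simp
  ultimately have "of_nat ` {..<p} = {x::'a. x ^ p = x}"
    by (intro card_seteq) auto
  then show ?thesis
    using that assms by blast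
qed

lemma field_aut_prime_field: "field_aut \<sigma> \<Longrightarrow> x ^ p = x \<Longrightarrow> \<sigma> x = (x::'a)"
  by (metis prime_field_of_nat field_aut_of_nat)

definition frob :: "'a \<Rightarrow> 'a" where "frob x = x ^ p"

lemma frob_funpow: "(frob ^^ i) x = x ^ (p ^ i)"
  by (induction i) (auto simp: frob_def power_mult[symmetric] mult.commute)

lemma frob_funpow_m: "frob ^^ m = id"
  by (rule ext) (metis frob_funpow card_field field_power_CARD id_apply)

lemma additive_frob: "additive frob"
  by (simp add: additive_def frob_def power_p_add)

lemma frob_funpow_add: "(frob ^^ i) (x + y) = (frob ^^ i) x + (frob ^^ i) y"
  by (meson additive.add additive_frob additive_funpow)

text \<open>A generator \<open>\<gamma>\<close> of the multiplicative group is a root of \<open>\<Prod>i<m. X - \<gamma> ^ (p ^ i)\<close>, whose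
  coefficients are fixed by the Frobenius map and hence by every automorphism.\<close>

lemma field_aut_eq_frob_funpow:
  assumes \<sigma>: "field_aut (\<sigma> :: 'a \<Rightarrow> 'a)"
  obtains i where "\<sigma> = frob ^^ i"
proof -
  obtain \<gamma> :: 'a where \<gamma>: "\<And>x. x \<noteq> 0 \<Longrightarrow> \<exists>i::nat. x = \<gamma> ^ i"
    using finite_field_generator by blast
  define f where "f = (\<Prod>i<m. [:- (\<gamma> ^ (p ^ i)), 1:])"
  \<comment> \<open>Frobenius shifts the roots of \<open>f\<close> cyclically, since
    \<open>\<gamma> ^ (p ^ m) = \<gamma>\<close>; so the coefficients lie in the prime
    field.\<close>
  have "map_poly frob f = (\<Prod>i<m. [:- (\<gamma> ^ (p ^ Suc i)), 1:])"
    unfolding f_def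
    by (subst map_poly_prod_linear[OF additive_frob])
       (auto simp: frob_def power_mult_distrib power_mult[symmetric] mult.commute)
  also have "\<dots> = f"
  proof -
    obtain n where n: "m = Suc n" using m_pos gr0_implies_Suc by blast
    have "\<gamma> ^ (p ^ m) = \<gamma>"
      by (metis card_field field_power_CARD)
    then show ?thesis
      unfolding f_def n prod.lessThan_Suc_shift[of "\<lambda>i. [:- (\<gamma> ^ (p ^ i)), 1:]" n]
        prod.lessThan_Suc[of "\<lambda>i. [:- (\<gamma> ^ (p ^ Suc i)), 1:]" n]
      by (simp add: n comp_def mult.commute del: mult_pCons_left mult_pCons_right)
  qed
  finally have "coeff f i ^ p = coeff f i" for i
    using coeff_map_poly[of frob f i] additive.zero[OF additive_frob] by (simp add: frob_def)
  then have "map_poly \<sigma> f = f"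
    using \<sigma> by (intro poly_eqI)
      (simp add: coeff_map_poly field_aut_zero field_aut_prime_field)
  then have "f = (\<Prod>i<m. [:- \<sigma> (\<gamma> ^ (p ^ i)), 1:])"
    unfolding f_def
    by (subst (asm) map_poly_prod_linear)
       (use \<sigma> in \<open>auto simp: field_aut_additive field_aut_mult field_aut_one\<close>)
  then have "poly f (\<sigma> \<gamma>) = (\<Prod>i<m. \<sigma> \<gamma> - \<sigma> (\<gamma> ^ (p ^ i)))"
    by (simp add: poly_prod)
  \<comment> \<open>The factor with \<open>i = 0\<close> vanishes.\<close>
  also have "\<dots> = 0"
    using m_pos by (auto simp: prod_zero_iff intro!: bexI[of _ 0])
  finally have "(\<Prod>i<m. \<sigma> \<gamma> - \<gamma> ^ (p ^ i)) = 0"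
    by (simp add: f_def poly_prod)
  then obtain i where i: "\<sigma> \<gamma> = (frob ^^ i) \<gamma>"
    by (auto simp: frob_funpow)
  have "\<sigma> x = (frob ^^ i) x" for x
  proof (cases "x = 0")
    case True
    then show ?thesis using \<sigma> p_gt_1 by (simp add: field_aut_zero frob_funpow power_0_left)
  next
    case False
    then obtain j where "x = \<gamma> ^ j" using \<gamma> by blast
    then show ?thesis
      using \<sigma> i by (simp add: field_aut_power frob_funpow power_mult[symmetric] mult.commute)
  qed
  then show ?thesis using that by blast
qed

text \<open>A trivial power with exponent \<open>0 < j < m\<close> would fix all
  \<open>p ^ m\<close> elements, but \<open>X ^ (p ^ j) - X\<close> has at most \<open>p ^ j\<close>
  roots.\<close>

lemma frob_funpow_eq_id_iff: "frob ^^ i = id \<longleftrightarrow> m dvd i"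
proof
  assume i: "frob ^^ i = id"
  show "m dvd i"
  proof (rule ccontr)
    assume "\<not> m dvd i"
    define j where "j = i mod m"
    have j: "0 < j" "j < m"
      using \<open>\<not> m dvd i\<close> m_pos by (auto simp: j_def dvd_eq_mod_eq_0)
    have "frob ^^ j = id"
      using i frob_funpow_m by (metis j_def funpow_mod_eq fun_eq_iff id_apply)
    then have "{x::'a. x ^ (p ^ j) = x} = UNIV"
      by (auto simp: frob_funpow[symmetric])
    then have "p ^ m \<le> p ^ j"
      using card_field card_fixed_points_le[OF j(1)] by simp
    then show False
      using j p_gt_1 by simp
  qed
next
  assume "m dvd i"
  then obtain k where "i = m * k" by blast
  then show "frob ^^ i = id"
    using frob_funpow_m by (metis funpow_mult id_funpow)
qed

lemma field_aut_commute:
  assumes "field_aut (\<sigma> :: 'a \<Rightarrow> 'a)" and "field_aut \<tau>"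
  shows "\<sigma> \<circ> \<tau> = \<tau> \<circ> \<sigma>"
proof -
  obtain i j where "\<sigma> = frob ^^ i" "\<tau> = frob ^^ j"
    using assms field_aut_eq_frob_funpow by metis
  then show ?thesis by (metis add.commute funpow_add)
qed

text \<open>In a cyclic group of order \<open>m\<close> the condition reads
  \<open>m dvd i * N\<close> for the exponent \<open>i < m\<close>, and
  \<open>i \<mapsto> i * N div m\<close> embeds these exponents into \<open>{..<N}\<close>.\<close>

lemma card_field_aut_torsion_le:
  assumes "N > 0"
  shows "card {\<sigma> :: 'a \<Rightarrow> 'a. field_aut \<sigma> \<and> \<sigma> ^^ N = id} \<le> N"
proof -
  let ?I = "{i. i < m \<and> m dvd i * N}"
  have sub: "{\<sigma>. field_aut \<sigma> \<and> \<sigma> ^^ N = id} \<subseteq> (\<lambda>i. frob ^^ i) ` ?I"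
  proof clarsimp
    fix \<sigma> :: "'a \<Rightarrow> 'a" assume \<sigma>: "field_aut \<sigma>" "\<sigma> ^^ N = id"
    obtain i where i: "\<sigma> = frob ^^ i"
      using \<sigma> field_aut_eq_frob_funpow by metis
    have "frob ^^ i = frob ^^ (i mod m)"
      by (rule ext) (simp add: funpow_mod_eq frob_funpow_m)
    moreover have "m dvd (i mod m) * N"
      using \<sigma> i frob_funpow_eq_id_iff by (metis calculation funpow_mult)
    ultimately show "\<sigma> \<in> (\<lambda>i. frob ^^ i) ` ?I"
      using i m_pos by auto
  qed
  have "card ?I \<le> card {..<N}"
  proof (rule card_inj_on_le)
    show "inj_on (\<lambda>i. i * N div m) ?I"
    proof (rule inj_onI)
      fix i j assume ij: "i \<in> ?I" "j \<in> ?I" "i * N div m = j * N div m"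
      then have "i * N = j * N"
        by (metis (mono_tags, lifting) dvd_div_mult_self mem_Collect_eq)
      then show "i = j" using assms by simp
    qed
    show "(\<lambda>i. i * N div m) ` ?I \<subseteq> {..<N}"
    proof clarsimp
      fix i assume "i < m"
      then have "i * N < N * m" using assms by (metis mult.commute mult_less_cancel1)
      then show "i * N div m < N" by (rule less_mult_imp_div_less)
    qed
  qed simp
  moreover have "card {\<sigma> :: 'a \<Rightarrow> 'a. field_aut \<sigma> \<and> \<sigma> ^^ N = id} \<le> card ?I"
    by (rule surj_card_le[OF _ sub]) simp
  ultimately show "card {\<sigma> :: 'a \<Rightarrow> 'a. field_aut \<sigma> \<and> \<sigma> ^^ N = id} \<le> N"
    by simp
qed

lemma field_aut_comp: "field_aut \<sigma> \<Longrightarrow> field_aut \<tau> \<Longrightarrow> field_aut (\<sigma> \<circ> \<tau>)"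
  unfolding field_aut_def by (metis bij_comp comp_apply)

lemma field_aut_funpow: "field_aut \<sigma> \<Longrightarrow> field_aut ((\<sigma> :: 'a \<Rightarrow> 'a) ^^ i)"
  by (induction i) (simp_all add: field_aut_comp, simp add: field_aut_def)

lemma field_aut_funpow_gcd:
  assumes "field_aut (\<phi> :: 'a \<Rightarrow> 'a)" and "\<phi> ^^ i = id" and "\<phi> ^^ j = id"
  shows "\<phi> ^^ gcd i j = id"
proof -
  obtain e where e: "\<phi> = frob ^^ e"
    using assms field_aut_eq_frob_funpow by metis
  then have "m dvd e * i" "m dvd e * j"
    using assms frob_funpow_eq_id_iff by (metis funpow_mult)+
  then have "m dvd e * gcd i j"
    by (simp add: gcd_mult_distrib_nat)
  then show ?thesis
    using e frob_funpow_eq_id_iff by (metis funpow_mult)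
qed

text \<open>The powers of \<open>\<phi>\<close> supply \<open>p ^ r\<close> distinct elements of the
  \<open>p ^ r\<close>-torsion, which has no room for others.\<close>

lemma field_aut_power_of_generator:
  assumes \<sigma>: "field_aut (\<sigma> :: 'a \<Rightarrow> 'a)" "\<sigma> ^^ (p ^ r) = id"
    and \<phi>: "field_aut \<phi>" "\<phi> ^^ (p ^ r) = id" "r > 0 \<Longrightarrow> \<phi> ^^ (p ^ (r - 1)) \<noteq> id"
  obtains i where "i < p ^ r" and "\<sigma> = \<phi> ^^ i"
proof -
  \<comment> \<open>A coincidence would make \<open>\<phi> ^^ (p ^ s) = id\<close> for some
    \<open>s < r\<close>, and hence \<open>\<phi> ^^ (p ^ (r - 1)) = id\<close>.\<close>
  have no: "i = j" if ij: "i \<le> j" "j < p ^ r" "\<phi> ^^ i = \<phi> ^^ j" for i j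
  proof (rule ccontr)
    assume "i \<noteq> j"
    define d where "d = j - i"
    have d: "0 < d" "d < p ^ r" using \<open>i \<noteq> j\<close> ij by (auto simp: d_def)
    have "(\<phi> ^^ i) ((\<phi> ^^ d) x) = (\<phi> ^^ i) x" for x
      using ij by (metis d_def comp_apply funpow_add le_add_diff_inverse)
    then have "\<phi> ^^ d = id"
      using field_aut_inj[OF field_aut_funpow[OF \<phi>(1)]] by (metis eq_id_iff)
    then have g: "\<phi> ^^ gcd d (p ^ r) = id"
      using \<phi> field_aut_funpow_gcd by blast
    obtain s where s: "s \<le> r" "gcd d (p ^ r) = p ^ s"
      using prime_p by (metis divides_primepow_nat gcd_dvd2)
    have "p ^ s < p ^ r"
      using d s by (metis gcd_le1_nat less_not_refl2 order_le_less_trans)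
    then have "s < r" using p_gt_1 by simp
    then have "p ^ (r - 1) = p ^ s * p ^ (r - 1 - s)"
      by (simp add: power_add[symmetric])
    then show False
      using g s \<phi>(3) \<open>s < r\<close> by (metis funpow_mult gr_zeroI id_funpow not_less_zero)
  qed
  have "inj_on (\<lambda>i. \<phi> ^^ i) {..<p ^ r}"
    using no by (metis (mono_tags, lifting) inj_onI lessThan_iff nat_le_linear)
  then have card: "card ((\<lambda>i. \<phi> ^^ i) ` {..<p ^ r}) = p ^ r"
    by (simp add: card_image)
  let ?A = "{\<sigma> :: 'a \<Rightarrow> 'a. field_aut \<sigma> \<and> \<sigma> ^^ (p ^ r) = id}"
  have pos: "p ^ r > 0" using p_gt_1 by simp
  have "(\<phi> ^^ i) ^^ (p ^ r) = id" for i
    using \<phi>(2) by (metis funpow_mult id_funpow mult.commute)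
  then have "(\<lambda>i. \<phi> ^^ i) ` {..<p ^ r} \<subseteq> ?A"
    using \<phi>(1) field_aut_funpow by auto
  then have "(\<lambda>i. \<phi> ^^ i) ` {..<p ^ r} = ?A"
    using card card_field_aut_torsion_le[OF pos] by (intro card_seteq) auto
  then show ?thesis
    using \<sigma> that by blast
qed

text \<open>With \<open>r\<close> least such that \<open>p ^ r\<close> kills \<open>A\<close>, a
  member of \<open>A\<close> not killed by \<open>p ^ (r - 1)\<close> generates the whole
  \<open>p ^ r\<close>-torsion. The generator is found inside \<open>A\<close>, so it is itself a
  value of the map under study.\<close>

lemma p_torsion_auts_cyclic:
  fixes A :: "('a \<Rightarrow> 'a) set"
  assumes "A \<noteq> {}" and A: "\<And>\<sigma>. \<sigma> \<in> A \<Longrightarrow> field_aut \<sigma> \<and> \<sigma> ^^ (p ^ k) = id"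
  obtains \<phi> r where "\<phi> \<in> A" and "\<phi> ^^ (p ^ r) = id"
    and "r > 0 \<Longrightarrow> \<phi> ^^ (p ^ (r - 1)) \<noteq> id"
    and "\<And>\<sigma>. \<sigma> \<in> A \<Longrightarrow> \<exists>i<p ^ r. \<sigma> = \<phi> ^^ i"
proof -
  define r where "r = (LEAST r. \<forall>\<sigma>\<in>A. \<sigma> ^^ (p ^ r) = id)"
  have r: "\<forall>\<sigma>\<in>A. \<sigma> ^^ (p ^ r) = id"
    unfolding r_def by (rule LeastI[of _ k]) (use A in blast)
  obtain \<phi> where \<phi>: "\<phi> \<in> A" "r > 0 \<Longrightarrow> \<phi> ^^ (p ^ (r - 1)) \<noteq> id"
  proof (cases "r = 0")
    case True
    then show ?thesis using that \<open>A \<noteq> {}\<close> by blast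
  next
    case False
    then have "r - 1 < r" by simp
    then have "\<not> (\<forall>\<sigma>\<in>A. \<sigma> ^^ (p ^ (r - 1)) = id)"
      unfolding r_def by (rule not_less_Least)
    then show ?thesis using that by blast
  qed
  show ?thesis
  proof
    show "\<exists>i<p ^ r. \<sigma> = \<phi> ^^ i" if "\<sigma> \<in> A" for \<sigma>
      using field_aut_power_of_generator[of \<sigma> r \<phi>] that A r \<phi> by metis
  qed (use \<phi> r in auto)
qed

lemma prime_field_pow_of_nat:
  assumes "g ^^ p = id"
  shows "prime_field_pow g (of_nat n :: 'a) = g ^^ n"
proof -
  define k where "k = (LEAST k. of_nat k = (of_nat n :: 'a))"
  have "of_nat k = (of_nat n :: 'a)"
    unfolding k_def by (rule LeastI) simp
  then have "k mod p = n mod p"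
    by (simp add: of_nat_eq_iff cong_def)
  then have "g ^^ k = g ^^ n"
    by (metis assms ext funpow_mod_eq id_apply)
  then show ?thesis
    by (simp add: prime_field_pow_def k_def)
qed

lemma aut_ord_props:
  assumes "field_aut (\<sigma> :: 'a \<Rightarrow> 'a)"
  shows "0 < aut_ord \<sigma>" and "\<sigma> ^^ aut_ord \<sigma> = id"
proof -
  obtain i where "\<sigma> = frob ^^ i"
    using field_aut_eq_frob_funpow[OF assms] .
  then have "\<sigma> ^^ m = id"
    using frob_funpow_m by (metis funpow_mult id_funpow mult.commute)
  with m_pos have "0 < m \<and> \<sigma> ^^ m = id" ..
  then have "0 < aut_ord \<sigma> \<and> \<sigma> ^^ aut_ord \<sigma> = id"
    unfolding aut_ord_def by (rule LeastI)
  then show "0 < aut_ord \<sigma>" and "\<sigma> ^^ aut_ord \<sigma> = id" by blast+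
qed

lemma order_p_funpow_eq:
  assumes g: "field_aut (g :: 'a \<Rightarrow> 'a)" "g ^^ p = id" "g \<noteq> id"
  shows "g ^^ i = g ^^ j \<longleftrightarrow> of_nat i = (of_nat j :: 'a)"
proof
  have *: "[i = j] (mod p)" if ij: "i \<le> j" "g ^^ i = g ^^ j" for i j
  proof -
    have "(g ^^ i) ((g ^^ (j - i)) x) = (g ^^ i) x" for x
      using ij by (metis comp_apply funpow_add le_add_diff_inverse)
    then have "(g ^^ (j - i)) x = x" for x
      using field_aut_inj[OF field_aut_funpow[OF g(1)]] by blast
    then have "g ^^ (j - i) = id"
      by (simp add: fun_eq_iff)
    then have gcd: "g ^^ gcd (j - i) p = id"
      using field_aut_funpow_gcd g by blast
    have "p dvd j - i"
    proof (rule ccontr)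
      assume "\<not> p dvd j - i"
      then have "gcd (j - i) p = 1"
        using prime_p by (metis coprime_commute coprime_iff_gcd_eq_1 prime_imp_coprime)
      then show False using gcd g(3) by simp
    qed
    then show ?thesis
      using ij(1) by (metis cong_altdef_nat cong_sym)
  qed
  show "of_nat i = (of_nat j :: 'a)" if "g ^^ i = g ^^ j"
    using *[of i j] *[of j i] that by (metis cong_sym nat_le_linear of_nat_eq_iff)
  show "g ^^ i = g ^^ j" if "of_nat i = (of_nat j :: 'a)"
    using that prime_field_pow_of_nat[OF g(2)] by metis
qed

section \<open>The trace form\<close>

abbreviation tr :: "'a \<Rightarrow> 'a" where "tr \<equiv> abs_trace p m"

lemma tr_eq_sum_frob: "tr x = (\<Sum>i<m. (frob ^^ i) x)"
  by (simp add: abs_trace_def frob_funpow)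

lemma additive_tr: "additive tr"
  by (simp add: additive_def tr_eq_sum_frob frob_funpow_add sum.distrib)

lemma tr_power_p: "tr x ^ p = tr x"
proof -
  have "frob (tr x) - tr x = (frob ^^ m) x - x"
    using dif_sum_funpow[OF additive_frob, where n = m and x = x] by (simp add: dif_def tr_eq_sum_frob)
  then show ?thesis by (simp add: frob_funpow_m frob_def)
qed

lemma tr_field_aut:
  assumes "field_aut \<sigma>"
  shows "tr (\<sigma> x) = tr x"
proof -
  have "tr (\<sigma> x) = \<sigma> (tr x)"
    using assms
    by (simp add: abs_trace_def additive.sum[OF field_aut_additive] field_aut_power)
  then show ?thesis
    by (simp add: field_aut_prime_field[OF assms tr_power_p])
qed

lemma tr_of_nat_mult: "tr (of_nat n * x) = of_nat n * tr x"
  by (rule additive_of_nat_mult[OF additive_tr])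

lemma add_subgroup_ker:
  assumes "additive f" shows "add_subgroup {x. f x = 0}"
  by (rule add_subgroupI) (simp_all add: additive.zero[OF assms] additive.diff[OF assms])

lemma card_ker_ge:
  fixes f :: "'a \<Rightarrow> 'a"
  assumes f: "additive f" and val: "\<And>x. f x ^ p = f x"
  shows "CARD('a) \<le> p * card {x. f x = 0}"
proof -
  have "range f \<subseteq> of_nat ` {..<p}"
    using val prime_field_of_nat by (metis image_subsetI imageI lessThan_iff)
  then have "card (range f) \<le> card {..<p}"
    by (rule surj_card_le[rotated]) simp
  then have range: "card (range f) \<le> p"
    by simp
  have "{x. f x = f y} \<subseteq> (\<lambda>k. k + y) ` {x. f x = 0}" for y
  proof
    fix x assume "x \<in> {x. f x = f y}"
    then show "x \<in> (\<lambda>k. k + y) ` {x. f x = 0}"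
      by (intro image_eqI[of _ _ "x - y"]) (simp_all add: additive.diff[OF f])
  qed
  then show ?thesis
    by (rule card_le_card_range_mult_kernel[OF _ finite range])
qed

text \<open>The trace has at most \<open>p\<close> values, which bounds its kernel from below; as a
  polynomial of degree \<open>p ^ (m - 1)\<close> it has at most that many roots.\<close>

lemma card_ker_tr: "p * card {x. tr x = 0} = CARD('a)"
proof (rule antisym)
  show "CARD('a) \<le> p * card {x. tr x = 0}"
    by (rule card_ker_ge[OF additive_tr tr_power_p])
  obtain n where n: "m = Suc n" using m_pos gr0_implies_Suc by blast
  define q where "q = (\<Sum>i<m. monom (1::'a) (p ^ i))"
  have "degree (\<Sum>i<n. monom (1::'a) (p ^ i)) < p ^ n" if "n > 0"
    by (rule degree_sum_less)
       (use p_gt_1 in \<open>auto simp: degree_monom_eq power_strict_increasing\<close>)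
  then have deg: "degree q = p ^ n" 
    by (cases "n > 0") (auto simp: q_def n degree_add_eq_right degree_monom_eq)
  then have "q \<noteq> 0"
    using p_gt_1 by auto
  then have "card {x. poly q x = 0} \<le> p ^ n"
    using card_poly_roots_bound deg by metis
  moreover have "poly q x = tr x" for x
    by (simp add: q_def abs_trace_def poly_sum poly_monom)
  ultimately show "p * card {x. tr x = 0} \<le> CARD('a)"
    using card_field n by simp
qed

text \<open>Double counting again: if no nonzero \<open>a\<close> multiplied \<open>H\<close> into
  the trace kernel, each nonzero \<open>a\<close> would have the count \<open>card H / p\<close>,
  against the exact sum of the counts.\<close>

lemma exists_annihilator:
  fixes H :: "'a set"
  assumes H: "add_subgroup H" and index: "p * card H = CARD('a)"
  obtains \<mu> where "\<mu> \<noteq> 0" and "\<And>h. h \<in> H \<Longrightarrow> tr (\<mu> * h) = 0"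
proof -
  let ?D = "{x. tr x = 0}"
  note D = add_subgroup_ker[OF additive_tr]
  let ?N = "\<lambda>a. card {b \<in> H. a * b \<in> ?D}"
  have "\<exists>\<mu>. \<mu> \<noteq> 0 \<and> (\<forall>h\<in>H. \<mu> * h \<in> ?D)"
  proof (rule ccontr)
    assume no: "\<not> ?thesis"
    have N: "p * ?N a = card H" if "a \<noteq> 0" for a
    proof (rule antisym)
      have "add_subgroup {b \<in> H. a * b \<in> ?D}"
        using H D by (auto simp: add_subgroup_def right_diff_distrib)
      moreover have "{b \<in> H. a * b \<in> ?D} \<subset> H"
        using no that by blast
      ultimately show "p * ?N a \<le> card H"
        using H card_proper_subgroup by blast
      have "card H * card ?D \<le> (p * card ?D) * ?N a"
        using card_mult_le_card_inter[OF H D] card_ker_tr by simp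
      moreover have "card ?D > 0"
        using D add_subgroup_zero by (metis card_gt_0_iff empty_iff finite)
      ultimately show "card H \<le> p * ?N a"
        by (simp add: ac_simps)
    qed
    have "card H > 0"
      using H add_subgroup_zero by (metis card_gt_0_iff empty_iff finite)
    have "p * (\<Sum>a\<in>UNIV. ?N a) = p * ?N 0 + (\<Sum>a\<in>UNIV - {0}. p * ?N a)"
      by (subst sum.remove[of UNIV "0"]) (auto simp: distrib_left sum_distrib_left)
    also have "\<dots> = p * card H + (CARD('a) - 1) * card H"
    proof -
      have "(\<Sum>a\<in>UNIV - {0}. p * ?N a) = (\<Sum>a\<in>UNIV - {0::'a}. card H)"
        by (rule sum.cong) (use N in auto)
      then show ?thesis
        by (simp add: card_Diff_singleton additive.zero[OF additive_tr])
    qed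
    finally have "p * (CARD('a) + (card H - 1) * card ?D) = p * card H + (CARD('a) - 1) * card H"
      using sum_card_mult_in[OF add_subgroup_zero[OF H] add_subgroup_zero[OF D]] by metis
    then have "p * CARD('a) + (card H - 1) * CARD('a) = CARD('a) + (CARD('a) - 1) * card H"
      using card_ker_tr index by (metis distrib_left mult.left_commute)
    moreover have "(card H - 1) * CARD('a) + CARD('a) = (CARD('a) - 1) * card H + card H"
      using \<open>card H > 0\<close>
      by (cases "card H"; cases "CARD('a)") auto
    ultimately have "p * CARD('a) + card H = 2 * CARD('a)"
      by linarith
    moreover have "2 * CARD('a) \<le> p * CARD('a)"
      using p_gt_1 by simp
    ultimately show False
      using \<open>card H > 0\<close> by linarith
  qed
  then show ?thesis using that by auto
qed

text \<open>An annihilator of the kernel of \<open>f\<close> gives a trace form with the same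
  kernel; two such functionals differ by a scalar of the prime field.\<close>

lemma functional_eq_tr:
  fixes f :: "'a \<Rightarrow> 'a"
  assumes f: "additive f" and val: "\<And>x. f x ^ p = f x"
  obtains \<mu> where "\<And>x. f x = tr (\<mu> * x)"
proof (cases "\<forall>x. f x = 0")
  case True
  then show ?thesis
    using that[of 0] by (simp add: additive.zero[OF additive_tr])
next
  case False
  then obtain x0 where x0: "f x0 \<noteq> 0" by blast
  let ?H = "{x. f x = 0}"
  note H = add_subgroup_ker[OF f]
  have index_ge: "p * card K \<le> CARD('a)" if "add_subgroup K" "K \<noteq> UNIV" for K :: "'a set"
    using card_proper_subgroup[of K UNIV] that by (auto simp: add_subgroup_def)
  have index: "p * card ?H = CARD('a)"
    using index_ge[OF H] x0 card_ker_ge[OF f val] by auto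
  then obtain \<mu> where \<mu>: "\<mu> \<noteq> 0" "\<And>h. f h = 0 \<Longrightarrow> tr (\<mu> * h) = 0"
    using exists_annihilator[OF H] by auto
  have add: "additive (\<lambda>x. tr (\<mu> * x))"
    by (simp add: additive_def distrib_left additive.add[OF additive_tr])
  have ker: "tr (\<mu> * x) = 0 \<longleftrightarrow> f x = 0" for x
  proof -
    have "{x. tr (\<mu> * x) = 0} \<noteq> UNIV"
    proof
      assume *: "{x. tr (\<mu> * x) = 0} = UNIV"
      have "tr x = 0" for x
      proof -
        have "x / \<mu> \<in> {x. tr (\<mu> * x) = 0}"
          unfolding * by (rule UNIV_I)
        then show ?thesis using \<mu>(1) by simp
      qed
      then show False
        using card_ker_tr p_gt_1 by simp
    qed
    then have "p * card {x. tr (\<mu> * x) = 0} \<le> CARD('a)"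
      using index_ge add_subgroup_ker[OF add] by blast
    then have "card {x. tr (\<mu> * x) = 0} \<le> card ?H"
      unfolding index[symmetric] using p_gt_1 by simp
    moreover have "?H \<subseteq> {x. tr (\<mu> * x) = 0}"
      using \<mu> by blast
    ultimately have "?H = {x. tr (\<mu> * x) = 0}"
      by (intro card_seteq) auto
    then show ?thesis by blast
  qed
  \<comment> \<open>\<open>k\<close> makes the two functionals agree at \<open>x0\<close>. As a
    quotient of prime field elements it is in the prime field, so it can be moved through
    \<open>tr\<close>.\<close>
  define k where "k = f x0 / tr (\<mu> * x0)"
  have "k ^ p = k"
    by (simp add: k_def power_divide val tr_power_p)
  then obtain n where n: "k = of_nat n"
    using prime_field_of_nat by blast
  have "f x = tr ((k * \<mu>) * x)" for x
  proof -
    have "(f x / f x0) ^ p = f x / f x0"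
      by (simp add: power_divide val)
    then obtain l where l: "f x / f x0 = of_nat l"
      using prime_field_of_nat by blast
    \<comment> \<open>Modulo the common kernel, every \<open>x\<close> is a prime field multiple of
      \<open>x0\<close>.\<close>
    have "f (x - of_nat l * x0) = 0"
      unfolding additive.diff[OF f] additive_of_nat_mult[OF f] using x0 l by (simp add: field_simps)
    then have "tr (\<mu> * (x - of_nat l * x0)) = 0"
      using ker by blast
    then have "tr (\<mu> * x) = of_nat l * tr (\<mu> * x0)"
      unfolding additive.diff[OF add] additive_of_nat_mult[OF add] by simp
    then have "tr (k * \<mu> * x) = of_nat l * (k * tr (\<mu> * x0))"
      unfolding n mult.assoc tr_of_nat_mult by (simp add: mult.left_commute)
    also have "\<dots> = f x"
      using ker[of x0] x0 l by (simp add: k_def field_simps)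
    finally show ?thesis by simp
  qed
  then show ?thesis using that by blast
qed

text \<open>Otherwise \<open>(\<mu> - \<nu>) * x\<close> runs through the field and the trace
  vanishes identically.\<close>

lemma tr_nondegenerate:
  assumes "\<And>x. tr (\<mu> * x) = tr (\<nu> * x)"
  shows "\<mu> = \<nu>"
proof (rule ccontr)
  assume "\<mu> \<noteq> \<nu>"
  have "tr x = 0" for x
  proof -
    have "x = \<mu> * (x / (\<mu> - \<nu>)) - \<nu> * (x / (\<mu> - \<nu>))"
      using \<open>\<mu> \<noteq> \<nu>\<close> by (metis left_diff_distrib nonzero_mult_div_cancel_left right_minus_eq times_divide_eq_right)
    then show ?thesis
      using assms additive.diff[OF additive_tr] by (metis diff_self)
  qed
  then show False
    using card_ker_tr p_gt_1 by simp
qed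

end

section \<open>Closed sets of semilinear maps\<close>

text \<open>Makes two subgroups of index at most \<open>m\<close> so large that the product of their
  sizes exceeds \<open>p ^ m\<close>.\<close>

lemma square_less_power:
  assumes "(3::nat) \<le> p"
  shows "m * m < p ^ m"
proof -
  have "m * m < 3 ^ m \<and> 2 * m + 1 \<le> 3 ^ m"
    by (induction m) (auto simp: algebra_simps)
  then show ?thesis
    using power_mono[OF assms, of m] by linarith
qed

text \<open>Used to exclude index \<open>p ^ r\<close> with \<open>r \<ge> 2\<close>. The inequality
  fails for \<open>p = 2\<close>, \<open>r = 2\<close>.\<close>

lemma Suc_le_power:
  assumes "(3::nat) \<le> p" and "2 \<le> r"
  shows "Suc r \<le> p ^ (r - 1)"
proof -
  have "Suc r \<le> 3 ^ (r - 1)"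
    using assms(2) by (induction r rule: nat_induct_at_least) (auto simp: Suc_diff_le power_eq_if)
  also have "\<dots> \<le> p ^ (r - 1)"
    by (rule power_mono[OF assms(1)]) simp
  finally show ?thesis .
qed

lemma Emat_nth:
  "Emat a b c t $ 1 = (vector [1, 0, 0, 0] :: 'a::field ^ 4)"
  "Emat a b c t $ 2 = vector [- c, 1, 0, 0]"
  "Emat a b c t $ 3 = vector [b - c * t, t, 1, 0]"
  "Emat a b c t $ 4 = vector [a, b, c, 1]"
  by (simp_all add: Emat_def vector_def)

lemma vector_4:
  "(vector [w, x, y, z] :: 'a::zero ^ 4) $ 1 = w"
  "(vector [w, x, y, z] :: 'a::zero ^ 4) $ 2 = x"
  "(vector [w, x, y, z] :: 'a::zero ^ 4) $ 3 = y"
  "(vector [w, x, y, z] :: 'a::zero ^ 4) $ 4 = z"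
  by (simp_all add: vector_def)

locale regular_group =
  finite_field_card p m "TYPE('a)" for p m and
    T :: "'a::{field,finite} \<Rightarrow> 'a \<Rightarrow> 'a \<Rightarrow> 'a" and
    \<theta> :: "'a \<Rightarrow> 'a \<Rightarrow> 'a \<Rightarrow> ('a \<Rightarrow> 'a)" +
  assumes odd_card: "odd CARD('a)"
    and aut: "\<And>a b c. field_aut (\<theta> a b c)"
    and closed: "\<And>x y. x \<in> Gset T \<theta> \<Longrightarrow> y \<in> Gset T \<theta> \<Longrightarrow> semilin_mult x y \<in> Gset T \<theta>"
begin

lemma p_ge_3: "3 \<le> p"
proof -
  have "odd p"
    using odd_card card_field m_pos by auto
  then have "p \<noteq> 2" by auto
  then show ?thesis using p_gt_1 by linarith
qed

lemma two_neq_0: "(2::'a) \<noteq> 0"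
proof -
  have "\<not> p dvd 2"
    using p_ge_3 by (auto dest: dvd_imp_le)
  then show ?thesis
    using of_nat_eq_0_iff[of 2] by simp
qed

section \<open>The product of triples\<close>

text \<open>This is the bottom row of the product of the two matrices, and that row labels the
  elements of \<open>Gset T \<theta>\<close>.\<close>

fun mul :: "'a \<times> 'a \<times> 'a \<Rightarrow> 'a \<times> 'a \<times> 'a \<Rightarrow> 'a \<times> 'a \<times> 'a" where
  "mul (a1, b1, c1) (a2, b2, c2) =
    (let \<sigma> = \<theta> a2 b2 c2; t = T a2 b2 c2 in
      (\<sigma> a1 - \<sigma> b1 * c2 + \<sigma> c1 * (b2 - c2 * t) + a2, \<sigma> b1 + \<sigma> c1 * t + b2, \<sigma> c1 + c2))"

fun th :: "'a \<times> 'a \<times> 'a \<Rightarrow> 'a \<Rightarrow> 'a" where "th (a, b, c) = \<theta> a b c"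
fun tt :: "'a \<times> 'a \<times> 'a \<Rightarrow> 'a" where "tt (a, b, c) = T a b c"

lemma th_aut: "field_aut (th x)"
  by (cases x) (simp add: aut)

text \<open>By closedness the product is \<open>gelem T \<theta> a b c\<close> for some triple; its
  bottom row identifies the triple as \<open>mul x y\<close>, and the entry in row 3, column 2 gives
  the law for \<open>T\<close>.\<close>

lemma mul_hom: "th (mul x y) = th y \<circ> th x" "tt (mul x y) = th y (tt x) + tt y"
proof -
  obtain a1 b1 c1 a2 b2 c2 where x: "x = (a1, b1, c1)" and y: "y = (a2, b2, c2)"
    by (metis prod_cases3)
  have "semilin_mult (gelem T \<theta> a1 b1 c1) (gelem T \<theta> a2 b2 c2) \<in> Gset T \<theta>"
    by (rule closed) (auto simp: Gset_def)
  then obtain a b c where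
    *: "semilin_mult (gelem T \<theta> a1 b1 c1) (gelem T \<theta> a2 b2 c2) = gelem T \<theta> a b c"
    by (auto simp: Gset_def)
  define \<sigma> where "\<sigma> = \<theta> a2 b2 c2"
  have \<sigma>: "field_aut \<sigma>" by (simp add: \<sigma>_def aut)
  have eq: "map_matrix \<sigma> (Emat a1 b1 c1 (T a1 b1 c1)) ** Emat a2 b2 c2 (T a2 b2 c2)
      = Emat a b c (T a b c)" and hom: "\<sigma> \<circ> \<theta> a1 b1 c1 = \<theta> a b c"
    using * by (auto simp: semilin_mult_def gelem_def \<sigma>_def)
  note entry = arg_cong[OF eq, of "\<lambda>A. A $ _ $ _"]
  note [simp] = matrix_matrix_mult_def sum_4 Emat_nth vector_4 field_aut_zero[OF \<sigma>] field_aut_one[OF \<sigma>]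
  have "c = \<sigma> c1 + c2"
    using entry[of 4 3] by simp
  moreover have "b = \<sigma> b1 + \<sigma> c1 * T a2 b2 c2 + b2"
    using entry[of 4 2] by simp
  moreover have "a = \<sigma> a1 - \<sigma> b1 * c2 + \<sigma> c1 * (b2 - c2 * T a2 b2 c2) + a2"
    using entry[of 4 1] by simp
  ultimately have m: "mul x y = (a, b, c)"
    by (simp add: x y \<sigma>_def Let_def)
  have "T a b c = \<sigma> (T a1 b1 c1) + T a2 b2 c2"
    using entry[of 3 2] by simp
  then show "tt (mul x y) = th y (tt x) + tt y"
    unfolding m by (simp add: x y \<sigma>_def)
  show "th (mul x y) = th y \<circ> th x"
    unfolding m using hom by (simp add: x y \<sigma>_def)
qed

lemma mul_inj_left: "mul x z = mul y z \<Longrightarrow> x = y"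
  by (cases x; cases y; cases z) (auto simp: Let_def field_aut_inj[OF aut])

text \<open>The right factor twists the left one, so its automorphism is recovered first, then its
  \<open>T\<close>, and only then its coordinates.\<close>

lemma mul_inj_right:
  assumes eq: "mul x y = mul x z" shows "y = z"
proof -
  have "th y \<circ> th x = th z \<circ> th x"
    using eq by (metis mul_hom(1))
  then have th: "th y = th z"
    using field_aut_surj[OF th_aut[of x]] by (metis comp_apply ext)
  moreover from this have "tt y = tt z"
    using eq mul_hom(2) by (metis add_left_cancel)
  ultimately show ?thesis
    using eq by (cases x; cases y; cases z) (auto simp: Let_def)
qed

lemma left_divide: obtains k where "mul k y = x"
proof -
  have "surj (\<lambda>k. mul k y)"
    by (rule finite_UNIV_inj_surj) (auto intro: injI mul_inj_left)
  then show ?thesis using that by (metis surjD)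
qed

lemma right_divide: obtains y where "mul x y = z"
proof -
  have "surj (mul x)"
    by (rule finite_UNIV_inj_surj) (auto intro: injI mul_inj_right)
  then show ?thesis using that by (metis surjD)
qed

lemma same_th:
  assumes "th x = th y"
  obtains k where "th k = id" and "mul k y = x"
proof -
  obtain k where k: "mul k y = x" by (rule left_divide)
  then have "th y (th k z) = th y z" for z
    using mul_hom(1) assms by (metis comp_apply)
  then have "th k = id"
    using field_aut_inj[OF th_aut[of y]] by (metis eq_id_iff)
  with k that show ?thesis by blast
qed

text \<open>Summing the Frobenius exponents of \<open>th (mul y x)\<close> over all \<open>y\<close> shows that the order of
  \<open>th x\<close> divides the number of triples.\<close>

lemma th_torsion: "th x ^^ (p ^ (3 * m)) = id"
proof -
  have "\<exists>i. th x = frob ^^ i" for x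
    using field_aut_eq_frob_funpow[OF th_aut[of x]] by metis
  then obtain e where e: "\<And>x. th x = frob ^^ e x"
    by metis
  have cong: "[e (mul y x) = e y + e x] (mod m)" for y
  proof -
    have "frob ^^ (e (mul y x)) = frob ^^ (e y + e x)"
      using mul_hom(1)[of y x] by (simp add: e funpow_add[symmetric] add.commute)
    moreover have "[i = j] (mod m)" if ij: "frob ^^ i = frob ^^ j" for i j
    proof -
      \<comment> \<open>Adding \<open>(m - 1) * j\<close> stands for subtracting \<open>j\<close>
        modulo \<open>m\<close>.\<close>
      have "frob ^^ (i + (m - 1) * j) = frob ^^ (m * j)"
        using ij m_pos by (metis funpow_add mult.commute mult_eq_if neq0_conv)
      then have "m dvd i + (m - 1) * j"
        using frob_funpow_eq_id_iff by (metis dvd_triv_left)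
      then have "[i + (m - 1) * j = j + (m - 1) * j] (mod m)"
        using m_pos by (metis cong_0_iff cong_sym cong_trans dvd_triv_left mult_eq_if neq0_conv)
      then show ?thesis
        by (simp add: cong_add_rcancel_nat)
    qed
    ultimately show ?thesis by blast
  qed
  have "bij (\<lambda>y. mul y x)"
    by (rule finite_UNIV_inj_surj[THEN bijI[rotated]]) (auto intro: injI mul_inj_left)
  then have "(\<Sum>y\<in>UNIV. e y) = (\<Sum>y\<in>UNIV. e (mul y x))"
    by (metis sum.reindex_bij_betw)
  also have "[\<dots> = (\<Sum>y\<in>UNIV. e y + e x)] (mod m)"
    by (rule cong_sum) (rule cong)
  finally have "[0 = CARD('a \<times> 'a \<times> 'a) * e x] (mod m)"
    by (simp add: sum.distrib cong_add_lcancel_0_nat cong_sym_eq[of "sum e UNIV"]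
        cong_sym_eq[of 0])
  then have "m dvd e x * CARD('a \<times> 'a \<times> 'a)"
    by (metis cong_0_iff cong_sym mult.commute)
  moreover have "CARD('a \<times> 'a \<times> 'a) = p ^ (3 * m)"
    by (simp add: card_prod card_field power_mult power3_eq_cube power_mult_distrib mult.assoc
        mult.commute[of 3])
  ultimately show ?thesis
    using e frob_funpow_eq_id_iff funpow_mult by metis
qed

lemma card_range_le: "(\<And>x. field_aut (f x)) \<Longrightarrow> card (range f) \<le> m" for f :: "'x \<Rightarrow> 'a \<Rightarrow> 'a"
proof -
  assume f: "\<And>x. field_aut (f x)"
  have "\<sigma> ^^ m = id" if "field_aut \<sigma>" for \<sigma> :: "'a \<Rightarrow> 'a"
    using field_aut_eq_frob_funpow[OF that] frob_funpow_m
    by (metis funpow_mult id_funpow mult.commute)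
  then have "range f \<subseteq> {\<sigma>. field_aut \<sigma> \<and> \<sigma> ^^ m = id}"
    using f by auto
  then show ?thesis
    using card_field_aut_torsion_le[OF m_pos] by (meson card_mono finite order_trans)
qed

lemma large_product:
  assumes "CARD('a) \<le> m * i" and "CARD('a) \<le> m * j"
  shows "CARD('a) < i * j"
proof -
  have pos: "CARD('a) > 0" by simp
  have "CARD('a) * CARD('a) \<le> (m * i) * (m * j)"
    using assms by (rule mult_le_mono)
  also have "\<dots> = (m * m) * (i * j)"
    by simp
  also have "\<dots> < CARD('a) * (i * j)"
  proof (rule mult_strict_right_mono)
    show "m * m < CARD('a)"
      using square_less_power[OF p_ge_3] card_field by simp
    show "0 < i * j"
      using assms pos by (cases i; cases j) auto
  qed
  finally show ?thesis by simp
qed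

section \<open>The elements with vanishing third coordinate\<close>

lemma mul_level_0:
  "T (\<theta> a2 b2 0 a1 + a2) (\<theta> a2 b2 0 b1 + b2) 0 = \<theta> a2 b2 0 (T a1 b1 0) + T a2 b2 0"
  "\<theta> (\<theta> a2 b2 0 a1 + a2) (\<theta> a2 b2 0 b1 + b2) 0 = \<theta> a2 b2 0 \<circ> \<theta> a1 b1 0"
  using mul_hom[of "(a1, b1, 0)" "(a2, b2, 0)"]
  by (simp_all add: Let_def field_aut_zero[OF aut])

lemma zero_level: "\<theta> 0 0 0 = id" "T 0 0 0 = 0"
proof -
  have "\<theta> 0 0 0 = \<theta> 0 0 0 \<circ> \<theta> 0 0 0"
    using mul_level_0(2)[of 0 0 0 0] by (simp add: field_aut_zero[OF aut])
  then show *: "\<theta> 0 0 0 = id"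
    using field_aut_inj[OF aut] by (metis comp_apply eq_id_iff)
  show "T 0 0 0 = 0"
    using mul_level_0(1)[of 0 0 0 0] by (metis * id_apply add_0_left add_cancel_right_right)
qed

text \<open>On the kernel of \<open>\<theta>\<close> at level \<open>c = 0\<close> the twists
  disappear, the product is addition and \<open>T\<close> is additive.\<close>

lemma kernel_diff:
  assumes "\<theta> a b 0 = id" and "\<theta> a' b' 0 = id"
  shows "\<theta> (a - a') (b - b') 0 = id" and "T (a - a') (b - b') 0 = T a b 0 - T a' b' 0"
  using mul_level_0[of a' b' "a - a'" "b - b'"] assms by (simp_all add: eq_diff_eq)

text \<open>These are the coordinates of the conjugate of \<open>(a, b, 0)\<close> by
  \<open>(a', b', c)\<close>, found as the solution \<open>y\<close> of
  \<open>mul ?x y = mul ?h ?x\<close>; \<open>a'\<close> and \<open>b'\<close> enter only through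
  \<open>\<sigma>\<close>.\<close>

lemma kernel_conj:
  fixes a b a' b' c :: 'a
  assumes "\<theta> a b 0 = id"
  defines "\<sigma> \<equiv> \<theta> a' b' c" and "t \<equiv> T a b 0"
  shows "\<theta> (\<sigma> a - 2 * c * \<sigma> b + c\<^sup>2 * \<sigma> t) (\<sigma> b - c * \<sigma> t) 0 = id" (is ?\<theta>)
    and "T (\<sigma> a - 2 * c * \<sigma> b + c\<^sup>2 * \<sigma> t) (\<sigma> b - c * \<sigma> t) 0 = \<sigma> t" (is ?T)
proof -
  let ?x = "(a', b', c)" and ?h = "(a, b, 0)"
  obtain y where y: "mul ?x y = mul ?h ?x"
    by (rule right_divide)
  have "th y \<circ> \<sigma> = \<sigma>"
    using mul_hom(1)[of ?x y] mul_hom(1)[of ?h ?x] y assms(1) by (simp add: \<sigma>_def)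
  then have th: "th y = id"
    using field_aut_surj[OF aut[of a' b' c]] by (metis \<sigma>_def comp_apply eq_id_iff)
  have "th y (tt ?x) + tt y = th ?x (tt ?h) + tt ?x"
    by (metis y mul_hom(2))
  then have tt: "tt y = \<sigma> t"
    by (simp add: th \<sigma>_def t_def)
  have "y = (\<sigma> a - 2 * c * \<sigma> b + c\<^sup>2 * \<sigma> t, \<sigma> b - c * \<sigma> t, 0)"
  proof (cases y)
    case (fields u v w)
    have "\<theta> u v w = id" "T u v w = \<sigma> t"
      using th tt fields by simp_all
    then have "w = 0" "c * \<sigma> t + v = \<sigma> b" "c * (v - w * \<sigma> t) + u = \<sigma> a - \<sigma> b * c"
      using y fields by (auto simp: Let_def \<sigma>_def field_aut_zero[OF aut] algebra_simps)
    then have v: "v = \<sigma> b - c * \<sigma> t" and u: "u = \<sigma> a - \<sigma> b * c - c * v"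
      by (simp_all add: algebra_simps)
    have "u = \<sigma> a - 2 * c * \<sigma> b + c\<^sup>2 * \<sigma> t"
      unfolding u v by (simp add: algebra_simps power2_eq_square)
    then show ?thesis
      using fields \<open>w = 0\<close> v by simp
  qed
  then show ?\<theta> ?T
    using th tt by simp_all
qed

subsection \<open>Triviality on the first coordinate\<close>

definition C0 :: "'a set" where "C0 = {c. \<exists>a b. \<theta> a b c = id}"

lemma C0_subgroup: "add_subgroup C0"
proof (rule add_subgroupI)
  show "0 \<in> C0" using zero_level by (auto simp: C0_def)
next
  fix c c' assume "c \<in> C0" "c' \<in> C0"
  then obtain a b a' b' where *: "\<theta> a b c = id" "\<theta> a' b' c' = id"
    by (auto simp: C0_def)
  then obtain k where k: "th k = id" "mul k (a', b', c') = (a, b, c)"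
    using same_th[of "(a, b, c)" "(a', b', c')"] by auto
  obtain u v w where "k = (u, v, w)" by (metis prod_cases3)
  with k * have "w + c' = c" "\<theta> u v w = id"
    by (auto simp: Let_def)
  then have "\<theta> u v (c - c') = id"
    by (metis add_diff_cancel_right')
  then show "c - c' \<in> C0"
    by (auto simp: C0_def)
qed

text \<open>There are at most \<open>m\<close> automorphisms, so the kernel of \<open>th\<close>
  contains at least one \<open>m\<close>-th of all triples, and it lies in
  \<open>UNIV \<times> UNIV \<times> C0\<close>.\<close>

lemma card_C0: "CARD('a) \<le> m * card C0"
proof -
  let ?K = "{x. th x = id}"
  have "CARD('a \<times> 'a \<times> 'a) \<le> m * card ?K"
  proof (rule card_le_card_range_mult_kernel)
    show "{x. th x = th y} \<subseteq> (\<lambda>k. mul k y) ` ?K" for y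
    proof
      fix x assume "x \<in> {x. th x = th y}"
      then obtain k where "th k = id" "mul k y = x"
        using same_th[of x y] by auto
      then show "x \<in> (\<lambda>k. mul k y) ` ?K" by auto
    qed
  qed (auto intro: card_range_le th_aut)
  also have "card ?K \<le> card ((UNIV::'a set) \<times> (UNIV::'a set) \<times> C0)"
    by (rule card_mono) (auto simp: C0_def, blast)
  then have "m * card ?K \<le> m * (CARD('a) * CARD('a) * card C0)"
    by (simp add: card_cartesian_product mult.assoc)
  finally have "CARD('a) * CARD('a) * CARD('a) \<le> CARD('a) * CARD('a) * (m * card C0)"
    by (simp add: card_prod ac_simps)
  then show ?thesis
    by simp
qed

definition A0 :: "'a set" where "A0 = {a. \<theta> a 0 0 = id \<and> T a 0 0 = 0}"

lemma A0_subgroup: "add_subgroup A0"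
  using kernel_diff[of _ 0 _ 0] zero_level by (intro add_subgroupI) (auto simp: A0_def)

text \<open>Conjugation by a kernel element with third coordinate \<open>c\<close> changes only the
  first coordinate, by \<open>- 2 * c * b\<close>; the difference with the original element lies in
  \<open>A0\<close>.\<close>

lemma mult_in_A0:
  assumes "\<theta> a b 0 = id" and "T a b 0 = 0" and "c \<in> C0"
  shows "c * (- 2 * b) \<in> A0"
proof -
  obtain a' b' where c: "\<theta> a' b' c = id"
    using assms(3) by (auto simp: C0_def)
  have "\<theta> (a - 2 * c * b) b 0 = id" "T (a - 2 * c * b) b 0 = 0"
    using kernel_conj[OF assms(1), of a' b' c] c assms(2) by simp_all
  then have "\<theta> (- 2 * c * b) 0 0 = id" "T (- 2 * c * b) 0 0 = 0"
    using kernel_diff[of "a - 2 * c * b" b a b] assms by simp_all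
  then show ?thesis
    by (simp add: A0_def ac_simps)
qed

text \<open>In both cases \<open>A0\<close> contains all products of \<open>C0\<close> with a
  subgroup large enough for \<open>products_in_proper_subgroup\<close>: a multiple of
  \<open>C0\<close> itself, or a multiple of the second coordinates of the kernel.\<close>

lemma A0_UNIV: "A0 = UNIV"
proof (cases "\<exists>a b. \<theta> a b 0 = id \<and> T a b 0 \<noteq> 0")
  case True
  then obtain a b where ab: "\<theta> a b 0 = id" "T a b 0 \<noteq> 0" by blast
  define t where "t = T a b 0"
  have t: "2 * t \<noteq> 0" using ab two_neq_0 by (simp add: t_def)
  note sub = add_subgroup_image_mult[OF C0_subgroup, of "2 * t"]
  have "card ((*) (2 * t) ` C0) = card C0"
    using t by (intro card_image) (auto simp: inj_on_def)
  then have big: "CARD('a) < card C0 * card ((*) (2 * t) ` C0)"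
    using large_product[OF card_C0 card_C0] by simp
  have "c' * x \<in> A0" if c': "c' \<in> C0" and x: "x \<in> (*) (2 * t) ` C0" for c' x
  proof -
    obtain c where c: "c \<in> C0" "x = 2 * t * c" using x by blast
    then obtain u v where uv: "\<theta> u v c = id" by (auto simp: C0_def)
    let ?a = "a - 2 * c * b + c\<^sup>2 * t" and ?b = "b - c * t"
    have "\<theta> ?a ?b 0 = id" "T ?a ?b 0 = t"
      using kernel_conj[OF ab(1), of u v c] uv by (simp_all add: t_def)
    \<comment> \<open>Conjugation preserves the value \<open>t\<close>, so the difference has
      \<open>T = 0\<close> and second coordinate \<open>- c * t\<close>; thus
      \<open>mult_in_A0\<close> applies to it.\<close>
    then have "\<theta> (?a - a) (?b - b) 0 = id" "T (?a - a) (?b - b) 0 = 0"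
      using kernel_diff[OF _ ab(1)] by (simp_all only: t_def diff_self)
    then have "c' * (- 2 * (?b - b)) \<in> A0"
      using c' by (rule mult_in_A0)
    moreover have "- 2 * (?b - b) = x"
      using c by simp
    ultimately show ?thesis by simp
  qed
  then show ?thesis
    using products_in_proper_subgroup[OF sub A0_subgroup _ big] by blast
next
  case False
  \<comment> \<open>Here \<open>T\<close> vanishes on the whole kernel at level 0, so
    \<open>mult_in_A0\<close> applies to every \<open>b \<in> B'\<close>.\<close>
  define B' where "B' = {b. \<exists>a. \<theta> a b 0 = id}"
  have B': "add_subgroup B'"
  proof (rule add_subgroupI)
    show "0 \<in> B'" using zero_level by (auto simp: B'_def)
    show "b - b' \<in> B'" if "b \<in> B'" "b' \<in> B'" for b b'
      using that kernel_diff(1) unfolding B'_def by blast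
  qed
  have card_B': "CARD('a) \<le> m * card B'"
  proof -
    let ?K = "{(a, b). \<theta> a b 0 = id}"
    have "CARD('a \<times> 'a) \<le> m * card ?K"
    proof (rule card_le_card_range_mult_kernel[of "\<lambda>(a, b). \<theta> a b 0"
          "\<lambda>(a', b') (a, b). (\<theta> a' b' 0 a + a', \<theta> a' b' 0 b + b')"])
      fix y :: "'a \<times> 'a"
      obtain a' b' where y: "y = (a', b')" by (metis surj_pair)
      show "{x. (case x of (a, b) \<Rightarrow> \<theta> a b 0) = (case y of (a, b) \<Rightarrow> \<theta> a b 0)}
        \<subseteq> (case y of (a', b') \<Rightarrow> \<lambda>(a, b). (\<theta> a' b' 0 a + a', \<theta> a' b' 0 b + b')) ` ?K"
      proof (clarsimp simp: y)
        fix a b assume ab: "\<theta> a b 0 = \<theta> a' b' 0"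
        obtain u v where uv: "\<theta> a' b' 0 u = a - a'" "\<theta> a' b' 0 v = b - b'"
          using field_aut_surj[OF aut] by metis
        then have "\<theta> a' b' 0 \<circ> \<theta> u v 0 = \<theta> a' b' 0"
          using mul_level_0(2)[of a' b' u v] ab by simp
        then have "\<theta> u v 0 = id"
          using field_aut_inj[OF aut] by (metis comp_apply eq_id_iff)
        then show "(a, b) \<in> (\<lambda>(a, b). (\<theta> a' b' 0 a + a', \<theta> a' b' 0 b + b')) ` ?K"
          using uv by (intro image_eqI[of _ _ "(u, v)"]) auto
      qed
    qed (auto intro: card_range_le aut)
    also have "card ?K \<le> card ((UNIV::'a set) \<times> B')"
      by (rule card_mono) (auto simp: B'_def)
    then have "m * card ?K \<le> m * (CARD('a) * card B')"
      by (simp add: card_cartesian_product)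
    finally have "CARD('a) * CARD('a) \<le> CARD('a) * (m * card B')"
      by (simp add: card_prod ac_simps)
    then show ?thesis by simp
  qed
  note sub = add_subgroup_image_mult[OF B', of "- 2"]
  have "card ((*) (- 2) ` B') = card B'"
    using two_neq_0 by (intro card_image) (auto simp: inj_on_def)
  then have big: "CARD('a) < card C0 * card ((*) (- 2) ` B')"
    using large_product[OF card_C0 card_B'] by simp
  have "c * x \<in> A0" if c: "c \<in> C0" and x: "x \<in> (*) (- 2) ` B'" for c x
  proof -
    obtain a b where "\<theta> a b 0 = id" "x = - 2 * b"
      using x unfolding B'_def by blast
    then show ?thesis
      using False mult_in_A0[OF _ _ c] by blast
  qed
  then show ?thesis
    using products_in_proper_subgroup[OF sub A0_subgroup _ big] by blast
qed

lemma \<theta>_level_0: "\<theta> a b 0 = \<theta> 0 b 0" and T_level_0: "T a b 0 = T 0 b 0"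
proof -
  have A0: "\<theta> x 0 0 = id" "T x 0 0 = 0" for x
    using A0_UNIV by (auto simp: A0_def)
  \<comment> \<open>With this \<open>x\<close>, the triple \<open>(a, b, 0)\<close> is the product
    of \<open>(x, 0, 0)\<close> and \<open>(0, b, 0)\<close>.\<close>
  obtain x where "\<theta> 0 b 0 x = a"
    using field_aut_surj[OF aut] by metis
  then show "\<theta> a b 0 = \<theta> 0 b 0" "T a b 0 = T 0 b 0"
    using mul_level_0[of 0 b x 0] A0 by (simp_all add: field_aut_zero[OF aut])
qed

subsection \<open>The second coordinate\<close>

definition \<beta> :: "'a \<Rightarrow> 'a \<Rightarrow> 'a" where "\<beta> b = \<theta> 0 b 0"
definition M :: "'a \<Rightarrow> 'a" where "M b = T 0 b 0"
definition B0 :: "'a set" where "B0 = {b. \<beta> b = id}"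

lemma \<beta>_aut: "field_aut (\<beta> b)"
  by (simp add: \<beta>_def aut)

lemma \<beta>_mul: "\<beta> (\<beta> b' b + b') = \<beta> b' \<circ> \<beta> b"
  and M_mul: "M (\<beta> b' b + b') = \<beta> b' (M b) + M b'"
  using mul_level_0[of 0 b' 0 b] by (simp_all add: \<beta>_def M_def field_aut_zero[OF aut])

lemma same_\<beta>:
  assumes "\<beta> b = \<beta> b'"
  obtains k where "k \<in> B0" and "b = \<beta> b' k + b'"
proof -
  obtain k where k: "\<beta> b' k = b - b'"
    using field_aut_surj[OF \<beta>_aut] by metis
  then have "\<beta> b' \<circ> \<beta> k = \<beta> b'"
    using \<beta>_mul[of b' k] assms by simp
  then have "\<beta> k x = x" for x
    using field_aut_inj[OF \<beta>_aut] by (metis comp_apply)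
  then have "k \<in> B0"
    by (simp add: B0_def fun_eq_iff)
  with k that show ?thesis by simp
qed

lemma B0_subgroup: "add_subgroup B0"
  and M_diff: "b \<in> B0 \<Longrightarrow> b' \<in> B0 \<Longrightarrow> M (b - b') = M b - M b'"
  using kernel_diff[of 0 _ 0] zero_level
  by (auto intro!: add_subgroupI simp: B0_def \<beta>_def M_def)

lemma B0_conj:
  assumes "b \<in> B0"
  shows "\<theta> a' b' c b - c * \<theta> a' b' c (M b) \<in> B0"
    and "M (\<theta> a' b' c b - c * \<theta> a' b' c (M b)) = \<theta> a' b' c (M b)"
  using kernel_conj[of 0 b a' b' c] assms
  unfolding B0_def \<beta>_def M_def mem_Collect_eq \<theta>_level_0[of "_ + _"] T_level_0[of "_ + _"] by blast+

text \<open>Otherwise \<open>M\<close> takes on \<open>B0\<close> a nonzero value \<open>t = M b\<close> fixed by all automorphisms involved.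
  Conjugating \<open>b\<close> by all elements of the group shows that every element of the field is of the form
  \<open>(\<phi> ^ i - 1) b\<close> modulo \<open>K = {k \<in> B0. M k = 0}\<close>. As \<open>\<phi> - 1\<close> is nilpotent, \<open>K\<close> is everything.\<close>

lemma M_B0:
  assumes "b0 \<in> B0" shows "M b0 = 0"
proof (rule ccontr)
  assume ne: "M b0 \<noteq> 0"
  obtain \<phi> r where \<phi>: "\<phi> \<in> range th" "\<phi> ^^ (p ^ r) = id"
    and gen: "\<And>\<sigma>. \<sigma> \<in> range th \<Longrightarrow> \<exists>i<p ^ r. \<sigma> = \<phi> ^^ i"
    by (rule p_torsion_auts_cyclic[of "range th" "3 * m"]) (use th_aut th_torsion in auto)
  have \<phi>_aut: "field_aut \<phi>"
    using \<phi>(1) th_aut by auto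
  note \<phi>_add = field_aut_additive[OF \<phi>_aut]
  obtain a' b' c' where \<phi>': "\<phi> = \<theta> a' b' c'"
    using \<phi>(1) by (auto elim: th.elims)
  have nil: "(dif \<phi> ^^ (p ^ r)) x = 0" for x
    using dif_funpow_prime_power[OF \<phi>_add prime_p CHAR_field] \<phi>(2) by simp
  have MB0: "dif \<phi> x \<in> M ` B0" if x: "x \<in> M ` B0" for x
  proof -
    obtain b where b: "b \<in> B0" "x = M b"
      using x by blast
    have "dif \<phi> x = M ((\<phi> b - c' * \<phi> (M b)) - b)"
      using B0_conj[OF b(1), of a' b' c'] M_diff b by (simp add: \<phi>' dif_def)
    moreover have "(\<phi> b - c' * \<phi> (M b)) - b \<in> B0"
      using B0_conj[OF b(1), of a' b' c'] B0_subgroup b add_subgroup_diff by (auto simp: \<phi>')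
    ultimately show ?thesis by blast
  qed
  \<comment> \<open>The last nonzero vector in the orbit of \<open>M b0\<close> under the nilpotent
    \<open>dif \<phi>\<close> is fixed by \<open>\<phi>\<close>, and it is again a value of
    \<open>M\<close> on \<open>B0\<close>.\<close>
  define n where "n = (LEAST n. (dif \<phi> ^^ n) (M b0) = 0)"
  have n: "(dif \<phi> ^^ n) (M b0) = 0"
    unfolding n_def by (rule LeastI) (rule nil)
  then have "n \<noteq> 0" using ne by (cases n) auto
  define t where "t = (dif \<phi> ^^ (n - 1)) (M b0)"
  have "t \<noteq> 0"
    using not_less_Least[of "n - 1" "\<lambda>n. (dif \<phi> ^^ n) (M b0) = 0"] \<open>n \<noteq> 0\<close>
    unfolding t_def n_def[symmetric] by simp
  have "dif \<phi> t = 0"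
    using n \<open>n \<noteq> 0\<close> by (cases n) (simp_all add: t_def)
  then have "\<phi> t = t" by (simp add: dif_def)
  then have "(\<phi> ^^ i) t = t" for i by (induction i) auto
  then have fixed: "th x t = t" for x
    using gen[of "th x"] by auto
  have "(dif \<phi> ^^ i) (M b0) \<in> M ` B0" for i
    using assms by (induction i) (auto intro: MB0)
  then obtain b where b: "b \<in> B0" "M b = t"
    unfolding t_def by (metis imageE)
  define K where "K = {k \<in> B0. M k = 0}"
  have M0: "M 0 = 0" using zero_level by (simp add: M_def)
  have K: "add_subgroup K"
    using B0_subgroup M_diff M0 by (auto simp: add_subgroup_def K_def)
  have "\<theta> a b c k \<in> K" if "k \<in> K" for a b c k
    using B0_conj[of k a b c] that by (simp add: K_def field_aut_zero[OF aut])
  then have K_dif: "dif \<phi> k \<in> K" if "k \<in> K" for k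
    using that K by (simp add: \<phi>' dif_def add_subgroup_diff)
  have step: "\<exists>z. y - dif \<phi> z \<in> K" for y
  proof -
    \<comment> \<open>Chosen so that the correction term \<open>c * ?\<sigma> t\<close> in the
      conjugate of \<open>b\<close> is exactly \<open>y\<close>.\<close>
    define c where "c = y / t"
    let ?\<sigma> = "th (0, 0, c)"
    obtain i where i: "?\<sigma> = \<phi> ^^ i" using gen[of ?\<sigma>] by blast
    let ?b = "?\<sigma> b - y"
    have "?b \<in> B0" "M ?b = t"
      using B0_conj[OF b(1), of 0 0 c] fixed[of "(0, 0, c)"] \<open>t \<noteq> 0\<close>
      by (simp_all add: b(2) c_def)
    then have "b - ?b \<in> K"
      using b B0_subgroup M_diff by (simp add: K_def add_subgroup_diff)
    moreover have "b - ?b = y - dif \<phi> (\<Sum>j<i. (\<phi> ^^ j) b)"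
      using dif_sum_funpow[OF \<phi>_add, where n = i and x = b] i by simp
    ultimately show ?thesis by metis
  qed
  \<comment> \<open>Iterating \<open>step\<close>, with \<open>K\<close> stable under
    \<open>dif \<phi>\<close>, shows that every power of \<open>dif \<phi>\<close> is onto modulo
    \<open>K\<close>; the power \<open>p ^ r\<close> is zero.\<close>
  have "\<exists>z. y - (dif \<phi> ^^ j) z \<in> K" for y j
  proof (induction j arbitrary: y)
    case 0
    then show ?case using K add_subgroup_zero by (metis diff_self funpow_0)
  next
    case (Suc j)
    obtain z where z: "y - dif \<phi> z \<in> K" using step by blast
    obtain z' where "z - (dif \<phi> ^^ j) z' \<in> K" using Suc by blast
    then have "dif \<phi> (z - (dif \<phi> ^^ j) z') \<in> K" by (rule K_dif)
    then have "dif \<phi> z - (dif \<phi> ^^ Suc j) z' \<in> K"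
      by (simp add: additive.diff[OF additive_dif[OF \<phi>_add]])
    with z have "(y - dif \<phi> z) + (dif \<phi> z - (dif \<phi> ^^ Suc j) z') \<in> K"
      by (rule add_subgroup_add[OF K])
    then show ?case
      by (metis add_diff_eq diff_add_cancel)
  qed
  then have "y \<in> K" for y
    using nil by (metis diff_zero)
  then show False
    using b \<open>t \<noteq> 0\<close> by (auto simp: K_def)
qed

lemma B0_invariant: "b \<in> B0 \<Longrightarrow> th x b \<in> B0"
  using B0_conj(1)[of b] M_B0[of b] field_aut_zero[OF aut]
  by (cases x) (metis diff_zero mult_zero_right th.simps)

text \<open>The sum is the second coordinate of the \<open>n\<close>-th power of
  \<open>(0, t, 0)\<close> under \<open>mul\<close>.\<close>

lemma sum_funpow_\<beta>:
  "\<beta> (\<Sum>i<n. (\<beta> t ^^ i) t) = \<beta> t ^^ n" (is ?\<beta>)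
  "M (\<Sum>i<n. (\<beta> t ^^ i) t) = (\<Sum>i<n. (\<beta> t ^^ i) (M t))" (is ?M)
proof -
  have "?\<beta> \<and> ?M"
  proof (induction n)
    case 0
    then show ?case using zero_level by (simp add: \<beta>_def M_def id_def)
  next
    case (Suc n)
    then show ?case
      unfolding sum_funpow_Suc[OF field_aut_additive[OF \<beta>_aut]] \<beta>_mul M_mul by simp
  qed
  then show ?\<beta> ?M by blast+
qed

text \<open>Both facts follow from \<open>r \<le> 1\<close>, where \<open>p ^ r\<close> is the order
  of a generator \<open>\<phi> = \<beta> t\<close> of the range of \<open>\<beta>\<close>.\<close>

lemma \<beta>_torsion: "\<beta> b ^^ p = id"
  and B0_index: "CARD('a) \<le> p * card B0"
proof -
  have tors: "\<beta> b ^^ (p ^ (3 * m)) = id" for b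
    using th_torsion[of "(0, b, 0)"] by (simp add: \<beta>_def)
  obtain \<phi> r where "\<phi> \<in> range \<beta>" and \<phi>: "\<phi> ^^ (p ^ r) = id"
    and ord: "r > 0 \<Longrightarrow> \<phi> ^^ (p ^ (r - 1)) \<noteq> id"
    and gen: "\<And>\<sigma>. \<sigma> \<in> range \<beta> \<Longrightarrow> \<exists>i<p ^ r. \<sigma> = \<phi> ^^ i"
    by (rule p_torsion_auts_cyclic[of "range \<beta>" "3 * m"]) (use \<beta>_aut tors in auto)
  then obtain t where t: "\<phi> = \<beta> t" by blast
  note \<phi>_add = field_aut_additive[OF \<beta>_aut[of t], folded t]
  have "range \<beta> \<subseteq> (\<lambda>i. \<phi> ^^ i) ` {..<p ^ r}"
    using gen by blast
  then have "card (range \<beta>) \<le> p ^ r"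
    using surj_card_le[of "{..<p ^ r}"] by simp
  moreover have "{b. \<beta> b = \<beta> b'} \<subseteq> (\<lambda>k. \<beta> b' k + b') ` B0" for b'
    using same_\<beta> by blast
  ultimately have index: "CARD('a) \<le> p ^ r * card B0"
    by (intro card_le_card_range_mult_kernel[where g = "\<lambda>b' k. \<beta> b' k + b'"]) auto
  have "r \<le> 1"
  proof (rule ccontr)
    assume "\<not> r \<le> 1"
    then have r: "Suc r \<le> p ^ (r - 1)"
      by (intro Suc_le_power p_ge_3) simp
    define n where "n = p ^ (r - 1)"
    have inv: "\<phi> x \<in> B0" if "x \<in> B0" for x
      using B0_invariant[OF that, of "(0, t, 0)"] by (simp add: t \<beta>_def)
    have "(dif \<phi> ^^ r) x \<in> B0" for x
      using dif_funpow_in_subgroup[OF B0_subgroup \<phi>_add \<phi> inv index] .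
    \<comment> \<open>As \<open>r \<le> n - 1\<close>, the operator
      \<open>dif \<phi> ^^ (n - 1)\<close> also maps into \<open>B0\<close>; it is the geometric
      sum, on which \<open>\<beta>\<close> takes the value \<open>\<phi> ^^ n\<close>.\<close>
    then have "(dif \<phi> ^^ (r + (n - 1 - r))) t \<in> B0"
      by (simp add: funpow_add)
    then have "(dif \<phi> ^^ (n - 1)) t \<in> B0"
      using r by (simp add: n_def)
    then have "(\<Sum>i<n. (\<phi> ^^ i) t) \<in> B0"
      using sum_funpow_prime_power[OF \<phi>_add prime_p CHAR_field, where k = "r - 1"] by (simp add: n_def)
    then have "\<phi> ^^ n = id"
      using sum_funpow_\<beta>(1)[of t n] by (simp add: t B0_def)
    then show False
      using ord \<open>\<not> r \<le> 1\<close> by (simp add: n_def)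
  qed
  then have "r = 0 \<or> r = 1" by linarith
  then have le: "p ^ r \<le> p" and \<phi>p: "\<phi> ^^ p = id"
    using p_gt_1 \<phi> by auto
  show "\<beta> b ^^ p = id"
    using gen[of "\<beta> b"] \<phi>p by (metis funpow_mult id_funpow mult.commute rangeI)
  show "CARD('a) \<le> p * card B0"
    using index le by (meson le_trans mult_le_mono1)
qed

text \<open>Index at most \<open>p\<close> leaves room for a single step of the chain, so the
  automorphisms \<open>th x\<close> act trivially modulo \<open>B0\<close>.\<close>

lemma th_dif_B0: "th x b - b \<in> B0"
  using dif_funpow_in_subgroup[OF B0_subgroup field_aut_additive[OF th_aut] th_torsion B0_invariant,
      where r = 1 and x = b] B0_index
  by (simp add: dif_def)

section \<open>The trace form of the second coordinate and the values of \<open>M\<close>\<close>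

text \<open>The twist in \<open>\<beta>_mul\<close> changes \<open>b\<close> only by an element of
  \<open>B0\<close>, which \<open>\<beta>\<close> does not see.\<close>

lemma \<beta>_add: "\<beta> (b + b') = \<beta> b \<circ> \<beta> b'"
proof -
  have k: "\<beta> (x + k) = \<beta> x" if "k \<in> B0" for x k
    using \<beta>_mul[of k x] that by (simp add: B0_def)
  have "b - \<beta> b' b \<in> B0"
    using th_dif_B0[of "(0, b', 0)" b] B0_subgroup add_subgroup_minus
    by (metis \<beta>_def minus_diff_eq th.simps)
  then have "\<beta> (b + b') = \<beta> (\<beta> b' b + b')"
    using k[of "b - \<beta> b' b" "\<beta> b' b + b'"] by (simp add: add.commute)
  then show ?thesis
    using \<beta>_mul field_aut_commute[OF \<beta>_aut \<beta>_aut] by simp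
qed

lemma \<beta>_eq_funpow:
  assumes g: "field_aut g" "g ^^ p = id" "g \<noteq> id"
  obtains i where "i < p" and "\<beta> b = g ^^ i"
  by (rule field_aut_power_of_generator[of "\<beta> b" 1 g]) (simp_all add: g \<beta>_aut \<beta>_torsion that)

lemma \<beta>_eq_prime_field_pow:
  assumes g: "field_aut g" "g ^^ p = id" "g \<noteq> id"
  obtains \<mu> where "\<And>b. \<beta> b = prime_field_pow g (tr (\<mu> * b))"
    and "\<And>b. b \<in> B0 \<longleftrightarrow> tr (\<mu> * b) = 0" and "\<And>x. th x \<mu> = \<mu>"
proof -
  have "\<exists>i. \<beta> b = g ^^ i" for b
    using \<beta>_eq_funpow[OF g] by blast
  then obtain n where n: "\<And>b. \<beta> b = g ^^ n b"
    by metis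
  \<comment> \<open>The exponent of \<open>g\<close> matters only modulo \<open>p\<close>; read in
    the prime field it becomes an additive functional.\<close>
  define f where "f b = (of_nat (n b) :: 'a)" for b
  have "additive f"
  proof
    fix b b'
    have "g ^^ n (b + b') = g ^^ (n b + n b')"
      using \<beta>_add[of b b'] by (simp add: n funpow_add)
    then show "f (b + b') = f b + f b'"
      using order_p_funpow_eq[OF g] by (simp add: f_def)
  qed
  moreover have "f b ^ p = f b" for b
    by (simp add: f_def of_nat_power_p)
  ultimately obtain \<mu> where \<mu>: "\<And>b. f b = tr (\<mu> * b)"
    using functional_eq_tr by metis
  have pow: "\<beta> b = prime_field_pow g (tr (\<mu> * b))" for b
    using prime_field_pow_of_nat[OF g(2), of "n b"] by (simp add: \<mu>[symmetric] f_def n)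
  have B0: "b \<in> B0 \<longleftrightarrow> tr (\<mu> * b) = 0" for b
    using order_p_funpow_eq[OF g, of "n b" 0] by (simp add: \<mu>[symmetric] f_def B0_def n id_def)
  \<comment> \<open>The functional is invariant under \<open>th x\<close> by
    \<open>th_dif_B0\<close>, and so is the trace; nondegeneracy carries the invariance over to
    \<open>\<mu>\<close>.\<close>
  have "th x \<mu> = \<mu>" for x
  proof (rule tr_nondegenerate)
    fix y
    obtain b where b: "y = th x b"
      using field_aut_surj[OF th_aut] by metis
    have "tr (\<mu> * (th x b - b)) = 0"
      using th_dif_B0 B0 by blast
    then have "tr (\<mu> * y) = tr (\<mu> * b)"
      by (simp add: b right_diff_distrib additive.diff[OF additive_tr])
    also have "\<dots> = tr (th x \<mu> * y)"
      using tr_field_aut[OF th_aut, of x "\<mu> * b"] by (simp add: b field_aut_mult[OF th_aut])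
    finally show "tr (th x \<mu> * y) = tr (\<mu> * y)" by simp
  qed
  then show ?thesis using that pow B0 by blast
qed

lemma M_eq_of_\<beta>_eq:
  assumes "\<beta> b = \<beta> b'" shows "M b = M b'"
proof -
  obtain k where "k \<in> B0" "b = \<beta> b' k + b'"
    using same_\<beta>[OF assms] .
  then show ?thesis
    by (simp add: M_mul M_B0 field_aut_zero[OF \<beta>_aut])
qed

lemma M_eq_sum:
  assumes g: "\<beta> t \<noteq> id"
  shows "(\<Sum>j<p. (\<beta> t ^^ j) (M t)) = 0"
    and "\<exists>N. N (\<beta> t ^^ 0) = 0 \<and> (\<forall>i\<in>{1..p - 1}. N (\<beta> t ^^ i) = (\<Sum>j<i. (\<beta> t ^^ j) (M t)))
          \<and> (\<forall>b. \<beta> b \<in> {\<beta> t ^^ i | i. i \<le> p - 1} \<and> M b = N (\<beta> b))"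
proof -
  \<comment> \<open>The \<open>p\<close>-th power of \<open>(0, t, 0)\<close> has trivial
    automorphism, so \<open>M\<close> vanishes there.\<close>
  have "(\<Sum>j<p. (\<beta> t ^^ j) t) \<in> B0"
    by (simp add: B0_def sum_funpow_\<beta>(1) \<beta>_torsion)
  then show "(\<Sum>j<p. (\<beta> t ^^ j) (M t)) = 0"
    using M_B0 sum_funpow_\<beta>(2) by metis
  \<comment> \<open>On the range of \<open>\<beta>\<close> the choice of \<open>b\<close> is
    immaterial by \<open>M_eq_of_\<beta>_eq\<close>.\<close>
  define N where "N h = M (SOME b. \<beta> b = h)" for h
  have N: "N (\<beta> b) = M b" for b
    unfolding N_def by (rule M_eq_of_\<beta>_eq) (rule someI, rule refl)
  have pow: "N (\<beta> t ^^ i) = (\<Sum>j<i. (\<beta> t ^^ j) (M t))" for i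
    using N sum_funpow_\<beta> by metis
  have "\<beta> b \<in> {\<beta> t ^^ i | i. i \<le> p - 1}" for b
  proof -
    obtain i where "i < p" "\<beta> b = \<beta> t ^^ i"
      using \<beta>_eq_funpow[OF \<beta>_aut \<beta>_torsion g] .
    moreover then have "i \<le> p - 1" by simp
    ultimately show ?thesis by blast
  qed
  then show "\<exists>N. N (\<beta> t ^^ 0) = 0
      \<and> (\<forall>i\<in>{1..p - 1}. N (\<beta> t ^^ i) = (\<Sum>j<i. (\<beta> t ^^ j) (M t)))
      \<and> (\<forall>b. \<beta> b \<in> {\<beta> t ^^ i | i. i \<le> p - 1} \<and> M b = N (\<beta> b))"
    using N pow[of 0] pow by (intro exI[of _ N]) auto
qed

text \<open>If \<open>\<beta> t\<close> were trivial, the exponent of the range would be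
  \<open>1\<close>, against \<open>\<beta> b \<noteq> id\<close>.\<close>

lemma \<beta>_generator_nontrivial:
  assumes ord: "aut_ord (\<beta> t) = aut_exponent (range \<beta>)" and b: "\<beta> b \<noteq> id"
  shows "\<beta> t \<noteq> id"
proof
  assume "\<beta> t = id"
  then have "aut_ord (\<beta> t) = 1"
    unfolding aut_ord_def by (intro Least_equality) auto
  moreover have "\<forall>\<sigma>\<in>range \<beta>. \<sigma> ^^ aut_exponent (range \<beta>) = id"
    unfolding aut_exponent_def
    by (rule LeastI2[of _ p]) (use \<beta>_torsion p_gt_1 in auto)
  ultimately show False
    using ord b by simp
qed

end

theorem theorem5p17:
  fixes p m :: nat
    and T :: "'a::{field,finite} \<Rightarrow> 'a \<Rightarrow> 'a \<Rightarrow> 'a"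
    and \<theta> :: "'a \<Rightarrow> 'a \<Rightarrow> 'a \<Rightarrow> ('a \<Rightarrow> 'a)"
    and g\<^sub>2 g\<^sub>B g\<^sub>C :: "'a \<Rightarrow> 'a"
    and M :: "'a \<Rightarrow> 'a"
    and t\<^sub>B t\<^sub>C :: 'a
  assumes "prime p" and "CARD('a) = p ^ m" and "odd (CARD('a))"
    and "\<And>a b c. field_aut (\<theta> a b c)"
    and "\<And>x y. x \<in> Gset T \<theta> \<Longrightarrow> y \<in> Gset T \<theta> \<Longrightarrow> semilin_mult x y \<in> Gset T \<theta>"
    and "\<exists>a b c. \<theta> a b c \<noteq> id"
    and "field_aut g\<^sub>2" and "aut_ord g\<^sub>2 = p"
    and "\<And>y. M y = T 0 y 0"
    and "g\<^sub>B = \<theta> 0 t\<^sub>B 0" and "aut_ord g\<^sub>B = aut_exponent {\<theta> 0 b 0 | b. True}"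
    and "g\<^sub>C = \<theta> 0 0 t\<^sub>C" and "aut_ord g\<^sub>C = Max {aut_ord (\<theta> 0 0 c) | c. True}"
  shows "\<exists>\<mu>\<^sub>B. g\<^sub>C \<mu>\<^sub>B = \<mu>\<^sub>B
    \<and> (\<forall>a b. \<theta> a b 0 = prime_field_pow g\<^sub>2 (abs_trace p m (\<mu>\<^sub>B * b)))
    \<and> (\<forall>a b. T a b 0 = M b)
    \<and> (\<forall>b \<in> {b. abs_trace p m (\<mu>\<^sub>B * b) = 0}. M b = 0)
    \<and> (\<mu>\<^sub>B \<noteq> 0 \<longrightarrow>
        (let \<nu>\<^sub>B = M t\<^sub>B in
          (\<Sum>j<p. (g\<^sub>B ^^ j) \<nu>\<^sub>B) = 0
          \<and> (\<exists>N\<^sub>B :: ('a \<Rightarrow> 'a) \<Rightarrow> 'a.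
               N\<^sub>B (g\<^sub>B ^^ 0) = 0
               \<and> (\<forall>i \<in> {1..p - 1}. N\<^sub>B (g\<^sub>B ^^ i) = (\<Sum>j<i. (g\<^sub>B ^^ j) \<nu>\<^sub>B))
               \<and> (\<forall>b. \<theta> 0 b 0 \<in> {g\<^sub>B ^^ i | i. i \<le> p - 1} \<and> M b = N\<^sub>B (\<theta> 0 b 0)))))"
proof -
  interpret G: regular_group p m T \<theta>
    by unfold_locales (use assms in auto)
  have M: "M = G.M"
    by (simp add: fun_eq_iff G.M_def assms)
  have \<theta>: "\<theta> 0 b 0 = G.\<beta> b" for b
    by (simp add: G.\<beta>_def)
  have g2: "g\<^sub>2 ^^ p = id"
    using G.aut_ord_props(2)[of g\<^sub>2] assms by simp
  have "g\<^sub>2 \<noteq> id"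
  proof
    assume "g\<^sub>2 = id"
    then have "aut_ord g\<^sub>2 = 1"
      unfolding aut_ord_def by (intro Least_equality) auto
    then show False using G.p_gt_1 assms by simp
  qed
  then obtain \<mu> where pow: "\<And>b. G.\<beta> b = prime_field_pow g\<^sub>2 (abs_trace p m (\<mu> * b))"
    and B0: "\<And>b. b \<in> G.B0 \<longleftrightarrow> abs_trace p m (\<mu> * b) = 0" and fixed: "\<And>x. G.th x \<mu> = \<mu>"
    using G.\<beta>_eq_prime_field_pow[OF assms(7) g2] by metis
  show ?thesis
  proof (intro exI[of _ \<mu>] conjI allI impI ballI)
    show "g\<^sub>C \<mu> = \<mu>"
      using fixed[of "(0, 0, t\<^sub>C)"] assms by simp
    show "\<theta> a b 0 = prime_field_pow g\<^sub>2 (abs_trace p m (\<mu> * b))" for a b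
      using pow G.\<theta>_level_0 \<theta> by metis
    show "T a b 0 = M b" for a b
      using G.T_level_0 assms(9) by metis
    show "M b = 0" if "b \<in> {b. abs_trace p m (\<mu> * b) = 0}" for b
      using that B0 G.M_B0 by (simp add: M)
    assume "\<mu> \<noteq> 0"
    \<comment> \<open>By nondegeneracy some \<open>\<beta> b\<close> is nontrivial, and the
      maximality of the order of \<open>g\<^sub>B\<close> then makes \<open>g\<^sub>B\<close>
      nontrivial.\<close>
    then obtain b where "abs_trace p m (\<mu> * b) \<noteq> 0"
      using G.tr_nondegenerate[of \<mu> 0] additive.zero[OF G.additive_tr] by auto
    then have "G.\<beta> b \<noteq> id"
      using B0 by (simp add: G.B0_def)
    moreover have "{\<theta> 0 b 0 | b. True} = range G.\<beta>"
      by (auto simp: \<theta>)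
    ultimately have gB: "G.\<beta> t\<^sub>B \<noteq> id"
      using G.\<beta>_generator_nontrivial[of t\<^sub>B b] assms \<theta> by simp
    show "let \<nu>\<^sub>B = M t\<^sub>B in
          (\<Sum>j<p. (g\<^sub>B ^^ j) \<nu>\<^sub>B) = 0
          \<and> (\<exists>N\<^sub>B :: ('a \<Rightarrow> 'a) \<Rightarrow> 'a.
               N\<^sub>B (g\<^sub>B ^^ 0) = 0
               \<and> (\<forall>i \<in> {1..p - 1}. N\<^sub>B (g\<^sub>B ^^ i) = (\<Sum>j<i. (g\<^sub>B ^^ j) \<nu>\<^sub>B))
               \<and> (\<forall>b. \<theta> 0 b 0 \<in> {g\<^sub>B ^^ i | i. i \<le> p - 1} \<and> M b = N\<^sub>B (\<theta> 0 b 0)))"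
      unfolding Let_def assms(10) \<theta> M using G.M_eq_sum[OF gB] by (rule conjI)
  qed
qed

end
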